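(* Let $\mathbb{F}$ be a field of characteristic zero and let $A$ be an algebra of Jordan type half over $\mathbb{F}$. Then either $A$ contains infinitely many primitive axes of Jordan type half, or $A$ is isomorphic to a Matsuo algebra $M_{1/2}(G,D)$ or to a factor algebra (quotient by an ideal) of such a Matsuo algebra.
   Context: All algebras are commutative but not necessarily associative. For $x$ in an algebra $A$, $A_\lambda(x)=\{u\in A:xu=\lambda u\}$. A primitive axis of Jordan type half is $x\neq0$ with $x^2=x$, $A=A_1(x)\oplus A_0(x)\oplus A_{1/2}(x)$, $A_1(x)=\mathbb{F}x$, and fusion rules $A_1A_1\subseteq A_1$, $A_1A_0=0$, $A_0A_0\subseteq A_0$, $A_1A_{1/2}\subseteq A_{1/2}$, $A_0A_{1/2}\subseteq A_{1/2}$, $A_{1/2}A_{1/2}\subseteq A_1\oplus A_0$ (eigenspaces of $x$). An algebra of Jordan type half is a commutative algebra generated by primitive axes of Jordan type half. A $3$-transposition group $(G,D)$ is a group $G$ with a conjugacy-invariant set $D$ of involutions generating $G$ such that $cd$ has order at most $3$ for all $c,d\in D$. The Matsuo algebra $M_{1/2}(G,D)$ over $\mathbb{F}$ has basis $D$ and product $c\cdot c=c$, $c\cdot d=0$ if $cd$ has order $2$, and $c\cdot d=\frac14(c+d-e)$ if $cd$ has order $3$, where $e=c^d=d^c$. *)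

theory Defs
  imports Main "HOL-Algebra.Multiplicative_Group" "HOL-Algebra.Generated_Groups"
begin

definition comm_algebra :: "('k::field \<Rightarrow> 'v::ab_group_add \<Rightarrow> 'v) \<Rightarrow> ('v \<Rightarrow> 'v \<Rightarrow> 'v) \<Rightarrow> bool" where
  "comm_algebra sc mul \<longleftrightarrow> vector_space sc
     \<and> (\<forall>u v. mul u v = mul v u)
     \<and> (\<forall>u v w. mul (u + v) w = mul u w + mul v w)
     \<and> (\<forall>a u w. mul (sc a u) w = sc a (mul u w))"

definition eigsp :: "('k::field \<Rightarrow> 'v::ab_group_add \<Rightarrow> 'v) \<Rightarrow> ('v \<Rightarrow> 'v \<Rightarrow> 'v) \<Rightarrow> 'v \<Rightarrow> 'k \<Rightarrow> 'v set" where
  "eigsp sc mul x l = {u. mul x u = sc l u}"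

definition prim_axis_half :: "('k::field \<Rightarrow> 'v::ab_group_add \<Rightarrow> 'v) \<Rightarrow> ('v \<Rightarrow> 'v \<Rightarrow> 'v) \<Rightarrow> 'v \<Rightarrow> bool" where
  "prim_axis_half sc mul x \<longleftrightarrow>
     (let A1 = eigsp sc mul x 1; A0 = eigsp sc mul x 0; Ah = eigsp sc mul x (1/2) in
       x \<noteq> 0 \<and> mul x x = x
       \<and> (\<forall>u. \<exists>u1 u0 uh. u1 \<in> A1 \<and> u0 \<in> A0 \<and> uh \<in> Ah \<and> u = u1 + u0 + uh)
       \<and> (\<forall>u1 u0 uh. u1 \<in> A1 \<and> u0 \<in> A0 \<and> uh \<in> Ah \<and> u1 + u0 + uh = 0
             \<longrightarrow> u1 = 0 \<and> u0 = 0 \<and> uh = 0)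
       \<and> A1 = range (\<lambda>a. sc a x)
       \<and> (\<forall>u\<in>A1. \<forall>v\<in>A1. mul u v \<in> A1)
       \<and> (\<forall>u\<in>A1. \<forall>v\<in>A0. mul u v = 0)
       \<and> (\<forall>u\<in>A0. \<forall>v\<in>A0. mul u v \<in> A0)
       \<and> (\<forall>u\<in>A1. \<forall>v\<in>Ah. mul u v \<in> Ah)
       \<and> (\<forall>u\<in>A0. \<forall>v\<in>Ah. mul u v \<in> Ah)
       \<and> (\<forall>u\<in>Ah. \<forall>v\<in>Ah. \<exists>w1\<in>A1. \<exists>w0\<in>A0. mul u v = w1 + w0))"

inductive_set gen_subalg :: "('k::field \<Rightarrow> 'v::ab_group_add \<Rightarrow> 'v) \<Rightarrow> ('v \<Rightarrow> 'v \<Rightarrow> 'v) \<Rightarrow> 'v set \<Rightarrow> 'v set"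
  for sc mul X where
  gen_base: "x \<in> X \<Longrightarrow> x \<in> gen_subalg sc mul X"
| gen_zero: "0 \<in> gen_subalg sc mul X"
| gen_add: "u \<in> gen_subalg sc mul X \<Longrightarrow> v \<in> gen_subalg sc mul X \<Longrightarrow> u + v \<in> gen_subalg sc mul X"
| gen_scale: "u \<in> gen_subalg sc mul X \<Longrightarrow> sc a u \<in> gen_subalg sc mul X"
| gen_mul: "u \<in> gen_subalg sc mul X \<Longrightarrow> v \<in> gen_subalg sc mul X \<Longrightarrow> mul u v \<in> gen_subalg sc mul X"

definition jordan_type_half_algebra :: "('k::field \<Rightarrow> 'v::ab_group_add \<Rightarrow> 'v) \<Rightarrow> ('v \<Rightarrow> 'v \<Rightarrow> 'v) \<Rightarrow> bool" where
  "jordan_type_half_algebra sc mul \<longleftrightarrow> comm_algebra sc mul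
     \<and> gen_subalg sc mul {x. prim_axis_half sc mul x} = UNIV"

definition three_transp_group :: "('g, 'b) monoid_scheme \<Rightarrow> 'g set \<Rightarrow> bool" where
  "three_transp_group G D \<longleftrightarrow> group G \<and> D \<subseteq> carrier G
     \<and> (\<forall>d\<in>D. group.ord G d = 2)
     \<and> (\<forall>g\<in>carrier G. \<forall>d\<in>D. inv\<^bsub>G\<^esub> g \<otimes>\<^bsub>G\<^esub> d \<otimes>\<^bsub>G\<^esub> g \<in> D)
     \<and> generate G D = carrier G
     \<and> (\<forall>c\<in>D. \<forall>d\<in>D. group.ord G (c \<otimes>\<^bsub>G\<^esub> d) \<in> {1, 2, 3})"

text \<open>Matsuo algebra M_{1/2}(G,D): elements are finitely supported functions D -> 'k
  (coordinates w.r.t. the basis D), with pointwise linear structure.\<close>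
definition matsuo_carrier :: "'g set \<Rightarrow> ('g \<Rightarrow> 'k::field) set" where
  "matsuo_carrier D = {a. finite {d. a d \<noteq> 0} \<and> (\<forall>d. a d \<noteq> 0 \<longrightarrow> d \<in> D)}"

definition delta :: "'g \<Rightarrow> 'g \<Rightarrow> 'k::field" where
  "delta c = (\<lambda>e. if e = c then 1 else 0)"

definition matsuo_bprod :: "('g, 'b) monoid_scheme \<Rightarrow> 'g \<Rightarrow> 'g \<Rightarrow> 'g \<Rightarrow> 'k::field" where
  "matsuo_bprod G c d =
     (if c = d then delta c
      else if group.ord G (c \<otimes>\<^bsub>G\<^esub> d) = 2 then (\<lambda>e. 0)
      else if group.ord G (c \<otimes>\<^bsub>G\<^esub> d) = 3 then
        (\<lambda>e. (1/4) * (delta c e + delta d e - delta (inv\<^bsub>G\<^esub> d \<otimes>\<^bsub>G\<^esub> c \<otimes>\<^bsub>G\<^esub> d) e))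
      else (\<lambda>e. 0))"

definition matsuo_mul :: "('g, 'b) monoid_scheme \<Rightarrow> ('g \<Rightarrow> 'k::field) \<Rightarrow> ('g \<Rightarrow> 'k) \<Rightarrow> 'g \<Rightarrow> 'k" where
  "matsuo_mul G a b = (\<lambda>e. \<Sum>c\<in>{c. a c \<noteq> 0}. \<Sum>d\<in>{d. b d \<noteq> 0}. a c * b d * matsuo_bprod G c d e)"

definition matsuo_hom :: "('g, 'b) monoid_scheme \<Rightarrow> 'g set \<Rightarrow> ('k::field \<Rightarrow> 'v::ab_group_add \<Rightarrow> 'v)
    \<Rightarrow> ('v \<Rightarrow> 'v \<Rightarrow> 'v) \<Rightarrow> (('g \<Rightarrow> 'k) \<Rightarrow> 'v) \<Rightarrow> bool" where
  "matsuo_hom G D sc mul f \<longleftrightarrow>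
     (\<forall>a\<in>matsuo_carrier D. \<forall>b\<in>matsuo_carrier D.
        f (\<lambda>e. a e + b e) = f a + f b \<and> f (matsuo_mul G a b) = mul (f a) (f b))
     \<and> (\<forall>t. \<forall>a\<in>matsuo_carrier D. f (\<lambda>e. t * a e) = sc t (f a))"

text \<open>Ideal of M_{1/2}(G,D) (the algebra is commutative, so one-sided suffices).\<close>
definition matsuo_ideal :: "('g, 'b) monoid_scheme \<Rightarrow> 'g set \<Rightarrow> ('g \<Rightarrow> 'k::field) set \<Rightarrow> bool" where
  "matsuo_ideal G D I \<longleftrightarrow> I \<subseteq> matsuo_carrier D \<and> (\<lambda>e. 0) \<in> I
     \<and> (\<forall>a\<in>I. \<forall>b\<in>I. (\<lambda>e. a e + b e) \<in> I)
     \<and> (\<forall>t. \<forall>a\<in>I. (\<lambda>e. t * a e) \<in> I)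
     \<and> (\<forall>a\<in>I. \<forall>b\<in>matsuo_carrier D. matsuo_mul G a b \<in> I)"

definition iso_matsuo :: "('g, 'b) monoid_scheme \<Rightarrow> 'g set \<Rightarrow> ('k::field \<Rightarrow> 'v::ab_group_add \<Rightarrow> 'v)
    \<Rightarrow> ('v \<Rightarrow> 'v \<Rightarrow> 'v) \<Rightarrow> bool" where
  "iso_matsuo G D sc mul \<longleftrightarrow>
     (\<exists>f. matsuo_hom G D sc mul f \<and> bij_betw f (matsuo_carrier D) UNIV)"

text \<open>(sc, mul) is isomorphic to the factor algebra M_{1/2}(G,D)/I for an ideal I:
  expressed by a surjective homomorphism f from M_{1/2}(G,D) onto the algebra whose
  kernel is exactly I (so f induces the isomorphism M/I -> A).\<close>
definition iso_matsuo_quot :: "('g, 'b) monoid_scheme \<Rightarrow> 'g set \<Rightarrow> ('k::field \<Rightarrow> 'v::ab_group_add \<Rightarrow> 'v)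
    \<Rightarrow> ('v \<Rightarrow> 'v \<Rightarrow> 'v) \<Rightarrow> bool" where
  "iso_matsuo_quot G D sc mul \<longleftrightarrow>
     (\<exists>I f. matsuo_ideal G D I \<and> matsuo_hom G D sc mul f
        \<and> f ` matsuo_carrier D = UNIV
        \<and> {a \<in> matsuo_carrier D. f a = 0} = I)"

end

(*
  The algebra is spanned by its axes, and it carries an associative symmetric form with
  (x, u) x = the projection of u to F x for every axis x.  Let the set of axes be finite and let a, b
  be distinct axes.

  If (a, b) is 0 or 1, the Miyamoto involutions of a and b generate a unipotent action on the
  subalgebra J = <<a, b>>, so finiteness forces ab = 0, respectively a = b.

  If (a, b) is none of 0, 1/4, 1, then J has an identity e, and a and b have the form (e + v)/2
  with v on the conic (v, v) = 2 in the plane V = J \<inter> e^perp.  The algebra decomposes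
  as F e + V + Z + U, where U is a module for the Clifford algebra of V and V Z = 0.  Using the
  eigenvalues of the rotation tau_a tau_b on the four summands one shows that the reflection attached
  to every point v of the conic is an automorphism of the whole algebra; the conic is rational, so this
  yields infinitely many axes, a contradiction.

  Hence (a, b) is 0 or 1/4 for all pairs, which gives exactly the Matsuo multiplication table, and the
  Miyamoto involutions (with a reflection in place of a trivial involution) are 3-transpositions.
*)

theory Submission
  imports Defs
begin

section \<open>Axes of Jordan type half\<close>

text \<open>The special role of 1/4 shows over an extension field. Write (a, b) = (c + 1)/2 and 2c =
  mu + 1/mu. The rotation rho = tau_a tau_b has eigenvalue 1 on e and Z, mu^2 and mu^-2 on V, mu and
  mu^-1 on U. Products of two eigenvectors in U therefore have eigenvalue mu^2, 1 or mu^-2, and a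
  component of U U in U forces mu = 1 or mu^3 = 1, that is, c = 1 or c = -1/2; the latter is (a, b)
  = 1/4. The field need not contain mu, so every such comparison is carried out with the relation
  R^2 = 2cR - 1 for the restriction R of rho to U. Components in V are found from the associativity
  of the form instead. A general point of the conic gives an idempotent x that is not known to be an
  axis. So its fusion rules are not examined: the polynomial that defines a Miyamoto involution is
  evaluated at x and shown to be multiplicative on each pair of summands. The new axes are the
  images of a under these maps, and their form values with a tell them apart.\<close>

locale comm_alg = vector_space scale
  for scale :: "'k::field_char_0 \<Rightarrow> 'v::ab_group_add \<Rightarrow> 'v" (infixr "*s" 75) +
  fixes mul :: "'v \<Rightarrow> 'v \<Rightarrow> 'v" (infixl "\<cdot>" 70)
  assumes mul_commute: "u \<cdot> v = v \<cdot> u"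
    and mul_add_left: "(u + v) \<cdot> w = u \<cdot> w + v \<cdot> w"
    and mul_scale_left: "(r *s u) \<cdot> w = r *s (u \<cdot> w)"
begin

lemma mul_add_right: "w \<cdot> (u + v) = w \<cdot> u + w \<cdot> v"
  by (metis mul_commute mul_add_left)

lemma mul_scale_right: "w \<cdot> (r *s u) = r *s (w \<cdot> u)"
  by (metis mul_commute mul_scale_left)

lemma mul_zero_left [simp]: "0 \<cdot> u = 0"
  by (metis mul_add_left add_cancel_left_left)

lemma mul_zero_right [simp]: "u \<cdot> 0 = 0"
  by (metis mul_commute mul_zero_left)

lemma mul_minus_left: "(- u) \<cdot> w = - (u \<cdot> w)"
  by (metis mul_add_left mul_zero_left add.right_inverse add_eq_0_iff)

lemma mul_minus_right: "w \<cdot> (- u) = - (w \<cdot> u)"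
  by (metis mul_commute mul_minus_left)

lemma mul_diff_left: "(u - v) \<cdot> w = u \<cdot> w - v \<cdot> w"
  by (metis mul_add_left mul_minus_left diff_conv_add_uminus)

lemma mul_diff_right: "w \<cdot> (u - v) = w \<cdot> u - w \<cdot> v"
  by (metis mul_commute mul_diff_left)

lemmas mul_simps = mul_add_left mul_add_right mul_scale_left mul_scale_right
  mul_minus_left mul_minus_right mul_diff_left mul_diff_right

section \<open>Linear functionals and linear maps\<close>

definition functional :: "('v \<Rightarrow> 'k) \<Rightarrow> bool" where
  "functional f \<longleftrightarrow> (\<forall>u v. f (u + v) = f u + f v) \<and> (\<forall>r u. f (r *s u) = r * f u)"

lemma
  assumes "functional f"
  shows functional_add: "f (u + v) = f u + f v"
    and functional_scale: "f (r *s u) = r * f u"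
    and functional_zero: "f 0 = 0"
    and functional_minus: "f (- u) = - f u"
    and functional_diff: "f (u - v) = f u - f v"
proof -
  show add: "f (u + v) = f u + f v" for u v
    using assms by (simp add: functional_def)
  show "f (r *s u) = r * f u"
    using assms by (simp add: functional_def)
  show zero: "f 0 = 0"
    using add[of 0 0] by simp
  show minus: "f (- u) = - f u" for u
    using add[of u "- u"] zero by (simp add: eq_neg_iff_add_eq_0 add.commute)
  show "f (u - v) = f u - f v"
    using add[of u "- v"] minus[of v] by simp
qed

lemmas functional_simps = functional_add functional_scale functional_zero functional_minus functional_diff

text \<open>Vector identities are reduced to ring identities by applying linear functionals.\<close>

lemma functional_eqI:
  assumes "\<And>f. functional f \<Longrightarrow> f u = f v"
  shows "u = v"
proof -
  define B where "B = extend_basis {}"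
  have B: "independent B" "span B = UNIV"
    unfolding B_def
    by (rule independent_extend_basis[OF independent_empty], rule span_extend_basis[OF independent_empty])
  have "representation B (u - v) b = 0" for b
  proof -
    have f: "functional (\<lambda>w. representation B w b)"
      using B by (simp add: functional_def representation_add representation_scale)
    from assms[OF this] functional_diff[OF this, of u v] show ?thesis
      by simp
  qed
  then have "u - v = 0"
    using sum_nonzero_representation_eq[of B "u - v"] B by simp
  then show ?thesis by simp
qed

text \<open>For a goal whose two sides differ by \<open>k\<close> times the difference of a known
  equation: after linear functionals are applied only a ring identity remains, and \<open>k\<close>
  is the one thing to supply.\<close>

lemma eq_by_scaling:
  assumes "l = r" "\<And>f. functional f \<Longrightarrow> f u - f v = k * (f l - f r)"
  shows "u = v"
  using assms by (auto intro!: functional_eqI)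

definition linear_map :: "('v \<Rightarrow> 'v) \<Rightarrow> bool" where
  "linear_map g \<longleftrightarrow> (\<forall>u v. g (u + v) = g u + g v) \<and> (\<forall>r u. g (r *s u) = r *s g u)"

lemma
  assumes "linear_map g"
  shows linear_map_add: "g (u + v) = g u + g v"
    and linear_map_scale: "g (r *s u) = r *s g u"
    and linear_map_zero: "g 0 = 0"
    and linear_map_minus: "g (- u) = - g u"
    and linear_map_diff: "g (u - v) = g u - g v"
proof -
  show add: "g (u + v) = g u + g v" for u v
    using assms by (simp add: linear_map_def)
  show "g (r *s u) = r *s g u"
    using assms by (simp add: linear_map_def)
  show zero: "g 0 = 0"
    using add[of 0 0] by simp
  show minus: "g (- u) = - g u" for u
    using add[of u "- u"] zero by (simp add: eq_neg_iff_add_eq_0 add.commute)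
  show "g (u - v) = g u - g v"
    using add[of u "- v"] minus[of v] by simp
qed

lemmas linear_map_simps = linear_map_add linear_map_scale linear_map_zero linear_map_minus linear_map_diff

definition automorphism :: "('v \<Rightarrow> 'v) \<Rightarrow> bool" where
  "automorphism g \<longleftrightarrow> linear_map g \<and> bij g \<and> (\<forall>u v. g (u \<cdot> v) = g u \<cdot> g v)"

abbreviation axis :: "'v \<Rightarrow> bool" where
  "axis \<equiv> prim_axis_half scale mul"

abbreviation axes :: "'v set" where
  "axes \<equiv> {x. axis x}"

text \<open>Membership in eigenspaces becomes an equation, so that an automorphism can carry over
  each clause separately.\<close>

lemma axis_iff:
  "axis x \<longleftrightarrow> x \<noteq> 0 \<and> x \<cdot> x = x
     \<and> (\<forall>u. \<exists>u1 u0 uh. x \<cdot> u1 = u1 \<and> x \<cdot> u0 = 0 \<and> x \<cdot> uh = (1/2) *s uh \<and> u = u1 + u0 + uh)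
     \<and> (\<forall>u1 u0 uh. x \<cdot> u1 = u1 \<and> x \<cdot> u0 = 0 \<and> x \<cdot> uh = (1/2) *s uh \<and> u1 + u0 + uh = 0
           \<longrightarrow> u1 = 0 \<and> u0 = 0 \<and> uh = 0)
     \<and> {u. x \<cdot> u = u} = range (\<lambda>r. r *s x)
     \<and> (\<forall>u v. x \<cdot> u = u \<longrightarrow> x \<cdot> v = v \<longrightarrow> x \<cdot> (u \<cdot> v) = u \<cdot> v)
     \<and> (\<forall>u v. x \<cdot> u = u \<longrightarrow> x \<cdot> v = 0 \<longrightarrow> u \<cdot> v = 0)
     \<and> (\<forall>u v. x \<cdot> u = 0 \<longrightarrow> x \<cdot> v = 0 \<longrightarrow> x \<cdot> (u \<cdot> v) = 0)
     \<and> (\<forall>u v. x \<cdot> u = u \<longrightarrow> x \<cdot> v = (1/2) *s v \<longrightarrow> x \<cdot> (u \<cdot> v) = (1/2) *s (u \<cdot> v))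
     \<and> (\<forall>u v. x \<cdot> u = 0 \<longrightarrow> x \<cdot> v = (1/2) *s v \<longrightarrow> x \<cdot> (u \<cdot> v) = (1/2) *s (u \<cdot> v))
     \<and> (\<forall>u v. x \<cdot> u = (1/2) *s u \<longrightarrow> x \<cdot> v = (1/2) *s v
           \<longrightarrow> (\<exists>w1. x \<cdot> w1 = w1 \<and> (\<exists>w0. x \<cdot> w0 = 0 \<and> u \<cdot> v = w1 + w0)))"
  unfolding prim_axis_half_def Let_def eigsp_def Ball_def Bex_def mem_Collect_eq scale_one scale_zero_left
  by (simp only: all_simps imp_conjL)

lemma axis_props:
  assumes "axis x"
  shows "x \<noteq> 0"
    "x \<cdot> x = x"
    "\<forall>u. \<exists>u1 u0 uh. x \<cdot> u1 = u1 \<and> x \<cdot> u0 = 0 \<and> x \<cdot> uh = (1/2) *s uh \<and> u = u1 + u0 + uh"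
    "\<forall>u1 u0 uh. x \<cdot> u1 = u1 \<and> x \<cdot> u0 = 0 \<and> x \<cdot> uh = (1/2) *s uh \<and> u1 + u0 + uh = 0
           \<longrightarrow> u1 = 0 \<and> u0 = 0 \<and> uh = 0"
    "{u. x \<cdot> u = u} = range (\<lambda>r. r *s x)"
    "\<forall>u v. x \<cdot> u = u \<longrightarrow> x \<cdot> v = v \<longrightarrow> x \<cdot> (u \<cdot> v) = u \<cdot> v"
    "\<forall>u v. x \<cdot> u = u \<longrightarrow> x \<cdot> v = 0 \<longrightarrow> u \<cdot> v = 0"
    "\<forall>u v. x \<cdot> u = 0 \<longrightarrow> x \<cdot> v = 0 \<longrightarrow> x \<cdot> (u \<cdot> v) = 0"
    "\<forall>u v. x \<cdot> u = u \<longrightarrow> x \<cdot> v = (1/2) *s v \<longrightarrow> x \<cdot> (u \<cdot> v) = (1/2) *s (u \<cdot> v)"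
    "\<forall>u v. x \<cdot> u = 0 \<longrightarrow> x \<cdot> v = (1/2) *s v \<longrightarrow> x \<cdot> (u \<cdot> v) = (1/2) *s (u \<cdot> v)"
    "\<forall>u v. x \<cdot> u = (1/2) *s u \<longrightarrow> x \<cdot> v = (1/2) *s v
           \<longrightarrow> (\<exists>w1. x \<cdot> w1 = w1 \<and> (\<exists>w0. x \<cdot> w0 = 0 \<and> u \<cdot> v = w1 + w0))"
  by (insert assms, unfold axis_iff, (elim conjE, assumption)+)

lemma
  assumes "axis x"
  shows axis_nonzero: "x \<noteq> 0"
    and axis_idem: "x \<cdot> x = x"
    and axis_one: "x \<cdot> u = u \<Longrightarrow> \<exists>r. u = r *s x"
    and axis_zero_zero: "x \<cdot> u = 0 \<Longrightarrow> x \<cdot> v = 0 \<Longrightarrow> x \<cdot> (u \<cdot> v) = 0"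
    and axis_zero_half: "x \<cdot> u = 0 \<Longrightarrow> x \<cdot> v = (1/2) *s v \<Longrightarrow> x \<cdot> (u \<cdot> v) = (1/2) *s (u \<cdot> v)"
proof -
  show "x \<noteq> 0" "x \<cdot> x = x" using axis_props(1)[OF assms] axis_props(2)[OF assms] .
  have "{u. x \<cdot> u = u} = range (\<lambda>r. r *s x)" using axis_props(5)[OF assms] .
  then show "x \<cdot> u = u \<Longrightarrow> \<exists>r. u = r *s x" by auto
  show "x \<cdot> u = 0 \<Longrightarrow> x \<cdot> v = 0 \<Longrightarrow> x \<cdot> (u \<cdot> v) = 0"
    using axis_props(8)[OF assms] by simp
  show "x \<cdot> u = 0 \<Longrightarrow> x \<cdot> v = (1/2) *s v \<Longrightarrow> x \<cdot> (u \<cdot> v) = (1/2) *s (u \<cdot> v)"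
    using axis_props(10)[OF assms] by simp
qed

lemma axis_decomp:
  assumes "axis x"
  obtains r u0 uh where "u = r *s x + u0 + uh" "x \<cdot> u0 = 0" "x \<cdot> uh = (1/2) *s uh"
proof -
  have "\<exists>u1 u0 uh. x \<cdot> u1 = u1 \<and> x \<cdot> u0 = 0 \<and> x \<cdot> uh = (1/2) *s uh \<and> u = u1 + u0 + uh"
    using axis_props(3)[OF assms] by (rule spec)
  with axis_one[OF assms] that show ?thesis by metis
qed

lemma axis_half_half:
  assumes "axis x" "x \<cdot> u = (1/2) *s u" "x \<cdot> v = (1/2) *s v"
  obtains r w0 where "u \<cdot> v = r *s x + w0" "x \<cdot> w0 = 0"
proof -
  have "\<exists>w1. x \<cdot> w1 = w1 \<and> (\<exists>w0. x \<cdot> w0 = 0 \<and> u \<cdot> v = w1 + w0)"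
    using assms(2,3) axis_props(11)[OF assms(1)] by (simp only: simp_thms)
  with axis_one[OF assms(1)] that show ?thesis by metis
qed

text \<open>The coefficient of \<open>x\<close> in \<open>u\<close>: if u = r x + u0 + uh, then x u
  = r x + uh/2 and x (x u) = r x + uh/4, so the half-part cancels in 2 x (x u) - x u. No choice of a
  decomposition is involved.\<close>

definition lam :: "'v \<Rightarrow> 'v \<Rightarrow> 'k" where
  "lam x u = (SOME r. r *s x = 2 *s (x \<cdot> (x \<cdot> u)) - x \<cdot> u)"

text \<open>The Miyamoto involution: 1 - 8t + 8t^2 takes the values 1, 1, -1 at t = 1, 0, 1/2. As a
  polynomial in multiplication by \<open>x\<close> it makes sense for every \<open>x\<close>, which
  matters for the points of the conic.\<close>

definition tau :: "'v \<Rightarrow> 'v \<Rightarrow> 'v" where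
  "tau x u = u - 8 *s (x \<cdot> u) + 8 *s (x \<cdot> (x \<cdot> u))"

lemma linear_map_tau: "linear_map (tau x)"
  unfolding linear_map_def tau_def
  by (auto intro!: functional_eqI simp: mul_simps functional_simps algebra_simps)

lemma lam_scale_eq:
  assumes "axis x"
  shows "lam x u *s x = 2 *s (x \<cdot> (x \<cdot> u)) - x \<cdot> u"
proof -
  obtain r u0 uh where u: "u = r *s x + u0 + uh" "x \<cdot> u0 = 0" "x \<cdot> uh = (1/2) *s uh"
    using axis_decomp[OF assms] by metis
  have "r *s x = 2 *s (x \<cdot> (x \<cdot> u)) - x \<cdot> u"
    by (rule functional_eqI)
       (simp add: u mul_simps functional_simps axis_idem[OF assms])
  then show ?thesis
    unfolding lam_def by (rule someI)
qed

lemma lam_eqI: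
  assumes "axis x" "2 *s (x \<cdot> (x \<cdot> u)) - x \<cdot> u = r *s x"
  shows "lam x u = r"
  using assms lam_scale_eq[OF assms(1), of u] axis_nonzero[OF assms(1)] by simp

lemma axis_mul_mul:
  assumes "axis x"
  shows "x \<cdot> (x \<cdot> u) = (1/2) *s (x \<cdot> u) + (lam x u / 2) *s x"
proof -
  have "(lam x u / 2) *s x = (1/2) *s (lam x u *s x)" by simp
  also have "\<dots> = (1/2) *s (2 *s (x \<cdot> (x \<cdot> u)) - x \<cdot> u)"
    by (simp only: lam_scale_eq[OF assms])
  finally show ?thesis by (simp add: scale_right_diff_distrib)
qed

lemma functional_lam:
  assumes "axis x"
  shows "functional (lam x)"
  unfolding functional_def
proof (intro conjI allI)
  fix u v :: 'v and r :: 'k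
  show "lam x (u + v) = lam x u + lam x v"
    by (rule lam_eqI[OF assms])
       (simp add: scale_left_distrib lam_scale_eq[OF assms] mul_simps scale_right_distrib)
  show "lam x (r *s u) = r * lam x u"
    by (rule lam_eqI[OF assms])
       (simp add: lam_scale_eq[OF assms] mul_simps scale_right_diff_distrib
          scale_scale[symmetric] scale_left_commute del: scale_scale)
qed

lemma lam_self: "axis x \<Longrightarrow> lam x x = 1"
  by (rule lam_eqI) (auto simp: axis_idem functional_simps intro!: functional_eqI)

lemma lam_orth: "axis x \<Longrightarrow> x \<cdot> u = 0 \<Longrightarrow> lam x u = 0"
  by (rule lam_eqI) auto

lemma tau_axis:
  assumes "axis x"
  shows "tau x u = u - 4 *s (x \<cdot> u) + (4 * lam x u) *s x"
  unfolding tau_def axis_mul_mul[OF assms]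
  by (rule functional_eqI) (simp add: functional_simps algebra_simps)

lemma tau_decomp:
  assumes "axis x" "x \<cdot> u0 = 0" "x \<cdot> uh = (1/2) *s uh"
  shows "tau x (r *s x + u0 + uh) = r *s x + u0 - uh"
  unfolding tau_def
  by (rule functional_eqI) (simp add: assms axis_idem mul_simps functional_simps algebra_simps)

lemma tau_self: "axis x \<Longrightarrow> tau x x = x"
  using tau_decomp[of x 0 0 1] by simp

lemma tau_tau [simp]:
  assumes "axis x"
  shows "tau x (tau x u) = u"
proof -
  obtain r u0 uh where u: "u = r *s x + u0 + uh" "x \<cdot> u0 = 0" "x \<cdot> uh = (1/2) *s uh"
    using axis_decomp[OF assms] by metis
  have "tau x (r *s x + u0 - uh) = r *s x + u0 + uh"
    using tau_decomp[OF assms u(2), of "- uh"] u by (simp add: mul_simps)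
  with tau_decomp[OF assms u(2,3)] u(1) show ?thesis by simp
qed

text \<open>The fusion rules say that A_1 + A_0 and A_1/2 are the even and odd parts of a grading by
  Z/2, and \<open>tau x\<close> is the sign change on the odd part.\<close>

lemma tau_mul:
  assumes x: "axis x"
  shows "tau x (u \<cdot> v) = tau x u \<cdot> tau x v"
proof -
  obtain r u0 uh where u: "u = r *s x + u0 + uh" "x \<cdot> u0 = 0" "x \<cdot> uh = (1/2) *s uh"
    using axis_decomp[OF x] by metis
  obtain s v0 vh where v: "v = s *s x + v0 + vh" "x \<cdot> v0 = 0" "x \<cdot> vh = (1/2) *s vh"
    using axis_decomp[OF x] by metis
  obtain t w0 where w: "uh \<cdot> vh = t *s x + w0" "x \<cdot> w0 = 0"
    using axis_half_half[OF x u(3) v(3)] by metis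
  have comm: "u0 \<cdot> x = 0" "uh \<cdot> x = (1/2) *s uh"
    using u by (simp_all add: mul_commute[of _ x])
  \<comment> \<open>The components of \<open>u \<cdot> v\<close> for the eigenvalues 1, 1/2 and 0 of
    \<open>x\<close>.\<close>
  define p where "p = (r * s + t) *s x"
  define h where "h = (r/2) *s vh + (s/2) *s uh + u0 \<cdot> vh + v0 \<cdot> uh"
  define z where "z = u0 \<cdot> v0 + w0"
  have h: "x \<cdot> h = (1/2) *s h"
    using axis_zero_half[OF x u(2) v(3)] axis_zero_half[OF x v(2) u(3)]
    by (simp add: h_def mul_simps u v scale_right_distrib scale_left_commute)
  have z: "x \<cdot> z = 0"
    using axis_zero_zero[OF x u(2) v(2)] w by (simp add: z_def mul_simps)
  have "u \<cdot> v = p + z + h"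
    unfolding u(1) v(1) p_def z_def h_def
    by (rule functional_eqI)
       (simp add: mul_simps functional_simps u(2,3) v(2,3) w comm axis_idem[OF x] mul_commute[of uh v0] algebra_simps)
  then have "tau x (u \<cdot> v) = p + z - h"
    using tau_decomp[OF x z h] by (simp add: p_def)
  also have "\<dots> = (r *s x + u0 - uh) \<cdot> (s *s x + v0 - vh)"
    unfolding p_def z_def h_def
    by (rule functional_eqI)
       (simp add: mul_simps functional_simps u(2,3) v(2,3) w comm axis_idem[OF x] mul_commute[of uh v0] algebra_simps)
  also have "\<dots> = tau x u \<cdot> tau x v"
    using tau_decomp[OF x u(2,3)] tau_decomp[OF x v(2,3)] u(1) v(1) by simp
  finally show ?thesis .
qed

lemma automorphism_tau:
  assumes "axis x"
  shows "automorphism (tau x)"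
  unfolding automorphism_def
  by (intro conjI linear_map_tau allI tau_mul[OF assms] o_bij[of "tau x"])
     (auto simp: assms)

lemma automorphism_axis:
  assumes g: "automorphism g" and x: "axis x"
  shows "axis (g x)"
proof -
  have lin: "linear_map g" and bij: "bij g" and mul: "\<And>u v. g u \<cdot> g v = g (u \<cdot> v)"
    using g by (auto simp: automorphism_def)
  have inj: "g u = g v \<longleftrightarrow> u = v" for u v
    using bij by (meson bij_is_inj inj_eq)
  have zero: "g u = 0 \<longleftrightarrow> u = 0" for u
    using inj[of u 0] linear_map_zero[OF lin] by simp
  have surj: "\<exists>u. w = g u" for w using bij by (metis bij_pointE)
  have all: "\<forall>w. P w" if "\<And>u. P (g u)" for P
    using surj that by metis
  note pull = mul linear_map_add[OF lin, symmetric] linear_map_scale[OF lin, symmetric] inj zero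
  have "{w. g x \<cdot> w = w} = g ` {u. x \<cdot> u = u}"
  proof (intro equalityI subsetI)
    fix w assume "w \<in> {w. g x \<cdot> w = w}"
    moreover obtain u where "w = g u" using surj by blast
    ultimately show "w \<in> g ` {u. x \<cdot> u = u}" by (simp add: mul inj)
  qed (auto simp: mul)
  also have "{u. x \<cdot> u = u} = range (\<lambda>r. r *s x)" using axis_props(5)[OF x] .
  also have "g ` range (\<lambda>r. r *s x) = range (\<lambda>r. r *s g x)"
    by (simp add: image_image linear_map_scale[OF lin])
  finally have A1: "{w. g x \<cdot> w = w} = range (\<lambda>r. r *s g x)" .
  show ?thesis
    unfolding axis_iff
  proof (intro conjI A1)
    show "g x \<noteq> 0" "g x \<cdot> g x = g x"
      unfolding pull using axis_props(1)[OF x] axis_props(2)[OF x] by auto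
    show "\<forall>w. \<exists>u1 u0 uh. g x \<cdot> u1 = u1 \<and> g x \<cdot> u0 = 0 \<and> g x \<cdot> uh = (1/2) *s uh \<and> w = u1 + u0 + uh"
    proof (rule all)
      fix u
      obtain u1 u0 uh where "x \<cdot> u1 = u1 \<and> x \<cdot> u0 = 0 \<and> x \<cdot> uh = (1/2) *s uh \<and> u = u1 + u0 + uh"
        using axis_props(3)[OF x] by blast
      then have "g x \<cdot> g u1 = g u1 \<and> g x \<cdot> g u0 = 0 \<and> g x \<cdot> g uh = (1/2) *s g uh \<and> g u = g u1 + g u0 + g uh"
        by (simp only: pull simp_thms)
      then show "\<exists>u1 u0 uh. g x \<cdot> u1 = u1 \<and> g x \<cdot> u0 = 0 \<and> g x \<cdot> uh = (1/2) *s uh \<and> g u = u1 + u0 + uh"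
        by blast
    qed
    show "\<forall>u v. g x \<cdot> u = (1/2) *s u \<longrightarrow> g x \<cdot> v = (1/2) *s v
           \<longrightarrow> (\<exists>w1. g x \<cdot> w1 = w1 \<and> (\<exists>w0. g x \<cdot> w0 = 0 \<and> u \<cdot> v = w1 + w0))"
    proof (intro all impI)
      fix u v assume "g x \<cdot> g u = (1/2) *s g u" "g x \<cdot> g v = (1/2) *s g v"
      then obtain w1 w0 where "x \<cdot> w1 = w1 \<and> x \<cdot> w0 = 0 \<and> u \<cdot> v = w1 + w0"
        unfolding pull using axis_props(11)[OF x] by blast
      then have "g x \<cdot> g w1 = g w1 \<and> g x \<cdot> g w0 = 0 \<and> g u \<cdot> g v = g w1 + g w0"
        by (simp only: pull simp_thms)
      then show "\<exists>w1. g x \<cdot> w1 = w1 \<and> (\<exists>w0. g x \<cdot> w0 = 0 \<and> g u \<cdot> g v = w1 + w0)"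
        by blast
    qed
    show "\<forall>u1 u0 uh. g x \<cdot> u1 = u1 \<and> g x \<cdot> u0 = 0 \<and> g x \<cdot> uh = (1/2) *s uh \<and> u1 + u0 + uh = 0
           \<longrightarrow> u1 = 0 \<and> u0 = 0 \<and> uh = 0"
      by (intro all, unfold pull) (use axis_props(4)[OF x] in blast)
    show "\<forall>u v. g x \<cdot> u = u \<longrightarrow> g x \<cdot> v = v \<longrightarrow> g x \<cdot> (u \<cdot> v) = u \<cdot> v"
      by (intro all, unfold pull) (use axis_props(6)[OF x] in blast)
    show "\<forall>u v. g x \<cdot> u = u \<longrightarrow> g x \<cdot> v = 0 \<longrightarrow> u \<cdot> v = 0"
      by (intro all, unfold pull) (use axis_props(7)[OF x] in blast)
    show "\<forall>u v. g x \<cdot> u = 0 \<longrightarrow> g x \<cdot> v = 0 \<longrightarrow> g x \<cdot> (u \<cdot> v) = 0"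
      by (intro all, unfold pull) (use axis_props(8)[OF x] in blast)
    show "\<forall>u v. g x \<cdot> u = u \<longrightarrow> g x \<cdot> v = (1/2) *s v \<longrightarrow> g x \<cdot> (u \<cdot> v) = (1/2) *s (u \<cdot> v)"
      by (intro all, unfold pull) (use axis_props(9)[OF x] in blast)
    show "\<forall>u v. g x \<cdot> u = 0 \<longrightarrow> g x \<cdot> v = (1/2) *s v \<longrightarrow> g x \<cdot> (u \<cdot> v) = (1/2) *s (u \<cdot> v)"
      by (intro all, unfold pull) (use axis_props(10)[OF x] in blast)
  qed
qed

lemma lam_automorphism:
  assumes g: "automorphism g" and x: "axis x"
  shows "lam (g x) (g u) = lam x u"
proof (rule lam_eqI[OF automorphism_axis[OF g x]])
  have lin: "linear_map g" and mul: "\<And>u v. g u \<cdot> g v = g (u \<cdot> v)"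
    using g by (auto simp: automorphism_def)
  show "2 *s (g x \<cdot> (g x \<cdot> g u)) - g x \<cdot> g u = lam x u *s g x"
    by (simp only: mul linear_map_simps[OF lin, symmetric] lam_scale_eq[OF x])
qed

lemma tau_automorphism:
  assumes g: "automorphism g"
  shows "tau (g x) (g u) = g (tau x u)"
proof -
  have lin: "linear_map g" and mul: "\<And>u v. g u \<cdot> g v = g (u \<cdot> v)"
    using g by (auto simp: automorphism_def)
  show ?thesis
    by (simp only: tau_def mul linear_map_simps[OF lin, symmetric])
qed

lemma axis_tau: "axis x \<Longrightarrow> axis y \<Longrightarrow> axis (tau x y)"
  by (rule automorphism_axis[OF automorphism_tau])

text \<open>The hypothesis puts \<open>y\<close> into F x + A_0(x). Multiplication by such an
  element maps each eigenspace of \<open>x\<close> into itself and hence commutes with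
  multiplication by \<open>x\<close>.\<close>

lemma seress:
  assumes x: "axis x" and y: "x \<cdot> y = r *s x"
  shows "x \<cdot> (y \<cdot> u) = y \<cdot> (x \<cdot> u)"
proof -
  obtain s u0 uh where u: "u = s *s x + u0 + uh" "x \<cdot> u0 = 0" "x \<cdot> uh = (1/2) *s uh"
    using axis_decomp[OF x] by metis
  define y0 where "y0 = y - r *s x"
  have y0: "x \<cdot> y0 = 0" "y = r *s x + y0"
    by (simp_all add: y0_def mul_simps y axis_idem[OF x])
  have "y0 \<cdot> x = 0" using y0 by (simp add: mul_commute)
  then show ?thesis
    unfolding u(1) y0(2)
    using axis_zero_zero[OF x y0(1) u(2)] axis_zero_half[OF x y0(1) u(3)]
    by (simp add: mul_simps u(2,3) axis_idem[OF x] y0(1) scale_right_distrib)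
qed

subsection \<open>Pairs of axes\<close>

text \<open>The subtracted half-sum cancels the term (a b)/2 of a (a b), so that \<open>a\<close>
  and \<open>b\<close> send \<open>sigma a b\<close> to multiples of themselves
  (\<open>mul_sigma\<close>). This is what makes \<open>seress\<close> applicable to it.\<close>

definition sigma :: "'v \<Rightarrow> 'v \<Rightarrow> 'v" where
  "sigma a b = a \<cdot> b - (1/2) *s (a + b)"

lemma sigma_commute: "sigma a b = sigma b a"
  by (simp add: sigma_def mul_commute add.commute)

lemma mul_eq_sigma: "a \<cdot> b = sigma a b + (1/2) *s (a + b)"
  by (simp add: sigma_def)

lemma mul_sigma:
  assumes a: "axis a"
  shows "a \<cdot> sigma a b = ((lam a b - 1) / 2) *s a"
  unfolding sigma_def
  by (rule functional_eqI)
     (simp add: mul_simps axis_mul_mul[OF a] axis_idem[OF a] functional_simps field_simps)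

text \<open>\<open>seress\<close> for \<open>a\<close> and for \<open>b\<close> evaluates sigma (a
  b) in two ways, with \<open>lam b a\<close> and with \<open>lam a b\<close> in the factor. If a b
  = 0 nothing can be cancelled, but then both values are 0.\<close>

lemma lam_commute:
  assumes a: "axis a" and b: "axis b"
  shows "lam a b = lam b a"
proof -
  have 1: "sigma a b \<cdot> (a \<cdot> b) = ((lam b a - 1) / 2) *s (a \<cdot> b)"
    using seress[OF a mul_sigma[OF a], of b b] mul_sigma[OF b, of a]
    by (simp add: sigma_commute[of b a] mul_commute[of _ b] mul_simps)
  have 2: "sigma a b \<cdot> (a \<cdot> b) = ((lam a b - 1) / 2) *s (a \<cdot> b)"
    using seress[OF b mul_sigma[OF b], of a a] mul_sigma[OF a, of b]
    by (simp add: sigma_commute[of b a] mul_commute[of _ a] mul_simps)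
  show ?thesis
  proof (cases "a \<cdot> b = 0")
    case True
    then show ?thesis using lam_orth[OF a, of b] lam_orth[OF b, of a] by (simp add: mul_commute)
  next
    case False
    with 1 2 show ?thesis by (simp add: scale_right_imp_eq)
  qed
qed

text \<open>Multiplication by sigma is the same scalar on \<open>a\<close>, \<open>b\<close> and
  \<open>a \<cdot> b\<close>, hence also on sigma. If the scalar is nonzero, a multiple of sigma is
  an identity for the subalgebra of \<open>a\<close> and \<open>b\<close>.\<close>

lemma sigma_mul_mul:
  assumes a: "axis a" and b: "axis b"
  shows "sigma a b \<cdot> sigma a b = ((lam a b - 1) / 2) *s sigma a b"
proof -
  have 1: "sigma a b \<cdot> (a \<cdot> b) = ((lam a b - 1) / 2) *s (a \<cdot> b)"
    using seress[OF b mul_sigma[OF b], of a a] mul_sigma[OF a, of b]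
    by (simp add: sigma_commute[of b a] mul_commute[of _ a] mul_simps)
  have 2: "sigma a b \<cdot> b = ((lam a b - 1) / 2) *s b"
    using mul_sigma[OF b, of a] by (simp add: sigma_commute[of b a] mul_commute[of _ b] lam_commute[OF a b])
  have "sigma a b \<cdot> sigma a b = sigma a b \<cdot> (a \<cdot> b) - (1/2) *s (sigma a b \<cdot> a + sigma a b \<cdot> b)"
    by (simp add: sigma_def[of a b] mul_simps)
  also have "\<dots> = ((lam a b - 1) / 2) *s sigma a b"
    unfolding 1 2 mul_commute[of _ a] mul_sigma[OF a]
    by (rule functional_eqI) (simp add: sigma_def functional_simps field_simps)
  finally show ?thesis .
qed

lemma tau_axis_eq:
  assumes a: "axis a"
  shows "tau a b = (4 * lam a b - 2) *s a - b - 4 *s sigma a b"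
  unfolding tau_axis[OF a] sigma_def
  by (rule functional_eqI) (simp add: functional_simps algebra_simps)

lemma tau_sigma:
  assumes a: "axis a"
  shows "tau a (sigma a b) = sigma a b"
  unfolding tau_def mul_sigma[OF a]
  by (rule functional_eqI) (simp add: functional_simps mul_simps mul_sigma[OF a] axis_idem[OF a] algebra_simps)

text \<open>Solving \<open>tau_axis\<close> for the product expresses x y by the three axes
  \<open>x\<close>, \<open>y\<close> and \<open>tau x y\<close>.\<close>

lemma mul_in_span_axes:
  assumes x: "axis x" and u: "u \<in> span axes"
  shows "x \<cdot> u \<in> span axes"
  using u
proof (induction rule: span_induct_alt)
  case base
  then show ?case by (simp add: span_zero)
next
  case (step r y u)
  then have y: "axis y" by simp
  have "x \<cdot> y = (1/4) *s y - (1/4) *s tau x y + lam x y *s x"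
    unfolding tau_axis[OF x] by (rule functional_eqI) (simp add: functional_simps algebra_simps)
  also have "\<dots> \<in> span axes"
    using x y axis_tau[OF x y] by (intro span_add span_diff span_scale span_base) auto
  finally show ?case using step by (simp add: mul_simps span_add span_scale)
qed

lemma span_axes_mul:
  assumes "u \<in> span axes" "v \<in> span axes"
  shows "u \<cdot> v \<in> span axes"
  using assms(1)
proof (induction rule: span_induct_alt)
  case base
  then show ?case by (simp add: span_zero)
next
  case (step r y u)
  then show ?case by (simp add: mul_simps span_add span_scale mul_in_span_axes assms(2))
qed

end

section \<open>The Frobenius form\<close>

locale half_algebra = comm_alg scale mul
  for scale :: "'k::field_char_0 \<Rightarrow> 'v::ab_group_add \<Rightarrow> 'v" (infixr "*s" 75)
    and mul :: "'v \<Rightarrow> 'v \<Rightarrow> 'v" (infixl "\<cdot>" 70) +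
  assumes generated: "gen_subalg scale mul axes = UNIV"
begin

lemma span_axes: "span axes = UNIV"
proof -
  have "u \<in> span axes" if "u \<in> gen_subalg scale mul axes" for u
    using that by induction (auto intro: span_base span_zero span_add span_scale span_axes_mul)
  with generated show ?thesis by auto
qed

lemma axes_induct [case_names zero add scale axis]:
  assumes "P 0" "\<And>u v. P u \<Longrightarrow> P v \<Longrightarrow> P (u + v)" "\<And>r u. P u \<Longrightarrow> P (r *s u)" "\<And>x. axis x \<Longrightarrow> P x"
  shows "P u"
proof -
  have "u \<in> span axes" by (simp add: span_axes)
  then show ?thesis
    by (induction rule: span_induct_alt) (use assms in auto)
qed

lemma functional_eq_on_axes:
  assumes f: "functional f" and g: "functional g" and eq: "\<And>x. axis x \<Longrightarrow> f x = g x"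
  shows "f u = g u"
  by (induction u rule: axes_induct) (simp_all add: functional_simps[OF f] functional_simps[OF g] eq)

lemma functional_cmult_add:
  assumes f: "functional f" and g: "functional g"
  shows "functional (\<lambda>w. f w + g w)" "functional (\<lambda>w. r * f w)"
  unfolding functional_def
  by (simp_all add: functional_simps[OF f] functional_simps[OF g] algebra_simps)

definition form :: "'v \<Rightarrow> 'v \<Rightarrow> 'k" where
  "form u = (SOME f. functional f \<and> (\<forall>x. axis x \<longrightarrow> f x = lam x u))"

text \<open>The axes span but may be linearly dependent, so values prescribed on them need not be
  consistent. For an axis \<open>y\<close> the functional \<open>lam y\<close> works by
  \<open>lam_commute\<close>, and existence passes to linear combinations.\<close>

lemma form_aux: "functional (form u) \<and> (\<forall>x. axis x \<longrightarrow> form u x = lam x u)"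
proof -
  have "\<exists>f. functional f \<and> (\<forall>x. axis x \<longrightarrow> f x = lam x u)"
  proof (induction u rule: axes_induct)
    case zero
    show ?case
      by (rule exI[of _ "\<lambda>_. 0"]) (auto simp: functional_def functional_zero[OF functional_lam])
  next
    case (add u v)
    then obtain f g where "functional f" "\<forall>x. axis x \<longrightarrow> f x = lam x u" "functional g" "\<forall>x. axis x \<longrightarrow> g x = lam x v"
      by blast
    then show ?case
      by (intro exI[of _ "\<lambda>w. f w + g w"]) (auto simp: functional_cmult_add functional_add[OF functional_lam])
  next
    case (scale r u)
    then obtain f where "functional f" "\<forall>x. axis x \<longrightarrow> f x = lam x u"
      by blast
    then show ?case
      by (intro exI[of _ "\<lambda>w. r * f w"]) (auto simp: functional_cmult_add functional_scale[OF functional_lam])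
  next
    case (axis y)
    then show ?case
      by (intro exI[of _ "lam y"]) (auto simp: functional_lam lam_commute)
  qed
  then show ?thesis unfolding form_def by (rule someI_ex)
qed

lemma functional_form: "functional (form u)"
  using form_aux by blast

lemma form_axis_right: "axis x \<Longrightarrow> form u x = lam x u"
  using form_aux by blast

lemma form_axis_left: "axis x \<Longrightarrow> form x u = lam x u"
  by (rule functional_eq_on_axes[OF functional_form functional_lam]) (auto simp: form_axis_right lam_commute)

lemma form_commute: "form u v = form v u"
proof (induction v rule: axes_induct)
  case (add v w)
  have "form (v + w) u = form v u + form w u"
    by (rule functional_eq_on_axes[OF functional_form functional_cmult_add(1)[OF functional_form functional_form]])
       (simp add: form_axis_right functional_add[OF functional_lam])
  with add show ?case by (simp add: functional_add[OF functional_form])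
next
  case (scale r v)
  have "form (r *s v) u = r * form v u"
    by (rule functional_eq_on_axes[OF functional_form functional_cmult_add(2)[OF functional_form functional_form]])
       (simp add: form_axis_right functional_scale[OF functional_lam])
  with scale show ?case by (simp add: functional_scale[OF functional_form])
next
  case zero
  have "form 0 u = 0"
    by (rule functional_eq_on_axes[OF functional_form])
       (auto simp: functional_def form_axis_right functional_zero[OF functional_lam])
  then show ?case by (simp add: functional_zero[OF functional_form])
qed (simp add: form_axis_left form_axis_right)

lemma functional_form_left: "functional (\<lambda>u. form u v)"
  using functional_form[of v] by (simp add: form_commute[of _ v])

lemmas form_simps = functional_simps[OF functional_form] functional_simps[OF functional_form_left]

lemma form_automorphism:
  assumes g: "automorphism g"
  shows "form (g u) (g v) = form u v"
proof -
  have lin: "linear_map g" using g by (simp add: automorphism_def)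
  show ?thesis
    by (induction u rule: axes_induct)
       (simp_all add: linear_map_simps[OF lin] form_simps form_axis_left lam_automorphism[OF g] automorphism_axis[OF g])
qed

text \<open>Multiplication by \<open>x\<close> is a combination of the identity, the isometric
  involution \<open>tau x\<close> and the projection to F x, and each of these is
  self-adjoint.\<close>

lemma form_mul_axis:
  assumes x: "axis x"
  shows "form (x \<cdot> u) v = form u (x \<cdot> v)"
proof -
  have eq: "x \<cdot> w = (1/4) *s w - (1/4) *s tau x w + lam x w *s x" for w
    unfolding tau_axis[OF x] by (rule functional_eqI) (simp add: functional_simps algebra_simps)
  have "form (tau x u) v = form u (tau x v)"
    using form_automorphism[OF automorphism_tau[OF x], of u "tau x v"] x by simp
  then show ?thesis
    unfolding eq by (simp add: form_simps form_axis_left[OF x] form_axis_right[OF x])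
qed

lemma form_mul: "form (w \<cdot> u) v = form u (w \<cdot> v)"
  by (induction w rule: axes_induct) (simp_all add: mul_simps form_simps form_mul_axis)

lemma form_mul': "form (u \<cdot> w) v = form u (w \<cdot> v)"
  using form_mul[of w u v] by (simp add: mul_commute)

end

section \<open>Pairs with unipotent rotation\<close>

lemma arith_progression_zero:
  fixes scale :: "'k::field_char_0 \<Rightarrow> 'v::ab_group_add \<Rightarrow> 'v"
  assumes "vector_space scale" "finite S" "\<And>n::nat. u + scale (of_nat n) v \<in> S"
  shows "v = 0"
proof (rule ccontr)
  interpret vector_space scale by fact
  assume "v \<noteq> 0"
  then have "inj (\<lambda>n::nat. u + scale (of_nat n) v)" by (auto simp: inj_def)
  then have "infinite (range (\<lambda>n::nat. u + scale (of_nat n) v))" by (simp add: finite_image_iff)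
  with assms(2,3) show False by (meson finite_subset image_subsetI)
qed

context comm_alg
begin

text \<open>With s = 4 a b, \<open>tau a\<close> maps \<open>b\<close> to b - s and both involutions
  negate \<open>s\<close>. So \<open>tau b\<close> after \<open>tau a\<close> translates
  \<open>b\<close> by \<open>s\<close> and fixes \<open>s\<close>, and the orbit of \<open>b\<close>
  is an arithmetic progression of axes.\<close>

lemma mul_zero_of_lam_zero:
  assumes fin: "finite axes" and a: "axis a" and b: "axis b" and "lam a b = 0"
  shows "a \<cdot> b = 0"
proof -
  define s where "s = 4 *s (a \<cdot> b)"
  have tau: "tau a u = u - 4 *s (a \<cdot> u) + (4 * lam a u) *s a" "tau b u = u - 4 *s (b \<cdot> u) + (4 * lam b u) *s b" for u
    by (simp_all add: tau_axis a b)
  have "lam b a = 0" using assms lam_commute by simp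
  then have taub: "tau b a = a - s" by (simp add: tau s_def mul_commute)
  have taua: "tau a b = b - s" by (simp add: tau s_def assms)
  have "tau a (b - tau a b) = tau a b - b" "tau b (a - tau b a) = tau b a - a"
    using a b by (simp_all add: linear_map_simps[OF linear_map_tau])
  then have "tau a s = - s" "tau b s = - s"
    by (simp_all add: taua taub)
  note t = taua taub this
  have "b + of_nat n *s s \<in> axes" for n
  proof (induction n)
    case 0
    then show ?case using b by simp
  next
    case (Suc n)
    have "tau b (tau a (b + of_nat n *s s)) = b + of_nat (Suc n) *s s"
      by (simp add: t tau_self[OF b] linear_map_simps[OF linear_map_tau])
         (rule functional_eqI, simp add: functional_simps algebra_simps)
    then show ?case using axis_tau a b Suc by (metis mem_Collect_eq)
  qed
  from arith_progression_zero[OF vector_space_axioms fin this] show ?thesis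
    by (simp add: s_def)
qed

text \<open>The rotation \<open>r\<close> is unipotent with a chain of length three, so the orbit of
  \<open>a\<close> may grow quadratically. Differences of axes grow linearly: b - a + 8ns is one for
  every n, which gives s = 0. After that a - 2n (b - a) is an axis for every n.\<close>

lemma eq_of_lam_one:
  assumes fin: "finite axes" and a: "axis a" and b: "axis b" and "lam a b = 1"
  shows "a = b"
proof -
  define s where "s = sigma a b"
  have ta: "tau a a = a" "tau a b = 2 *s a - b - 4 *s s" "tau a s = s"
    using tau_self[OF a] tau_axis_eq[OF a, of b] tau_sigma[OF a, of b] assms by (simp_all add: s_def)
  have tb: "tau b b = b" "tau b a = 2 *s b - a - 4 *s s" "tau b s = s"
    using tau_self[OF b] tau_axis_eq[OF b, of a] tau_sigma[OF b, of a] assms lam_commute[OF a b]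
    by (simp_all add: s_def sigma_commute[of b a])
  define r where "r = (\<lambda>u. tau a (tau b u))"
  have r_axis: "axis (r u)" if "axis u" for u using that a b axis_tau by (simp add: r_def)
  have r: "r a = a - 2 *s (b - a) - 12 *s s" "r (b - a) = (b - a) + 8 *s s" "r s = s"
    unfolding r_def linear_map_simps[OF linear_map_tau] ta tb
    by (rule functional_eqI, simp add: functional_simps linear_map_simps[OF linear_map_tau] ta tb algebra_simps)+
  have r_lin: "linear_map r" unfolding linear_map_def r_def by (simp add: linear_map_simps[OF linear_map_tau])
  have s0: "s = 0"
  proof -
    define S where "S = (\<lambda>(x, y). x - y) ` (axes \<times> axes)"
    have "finite S" unfolding S_def using fin by simp
    moreover have "(b - a) + of_nat n *s (8 *s s) \<in> S" for n
    proof (induction n)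
      case 0
      then show ?case using a b by (auto simp: S_def)
    next
      case (Suc n)
      then obtain x y where xy: "axis x" "axis y" "(b - a) + of_nat n *s (8 *s s) = x - y"
        by (auto simp: S_def)
      have "(b - a) + of_nat (Suc n) *s (8 *s s) = r ((b - a) + of_nat n *s (8 *s s))"
        by (simp only: linear_map_add[OF r_lin] linear_map_scale[OF r_lin] r of_nat_Suc scale_left_distrib scale_one add.assoc)
      also have "\<dots> = r x - r y" by (simp only: xy linear_map_diff[OF r_lin])
      finally show ?case using r_axis xy unfolding S_def by (metis (no_types, lifting) SigmaI case_prod_conv image_eqI mem_Collect_eq)
    qed
    ultimately have "8 *s s = 0" using arith_progression_zero[OF vector_space_axioms] by blast
    then show ?thesis by simp
  qed
  have "a + of_nat n *s (- (2 *s (b - a))) \<in> axes" for n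
  proof (induction n)
    case 0
    then show ?case using a by simp
  next
    case (Suc n)
    have "r (a + of_nat n *s (- (2 *s (b - a)))) = a + of_nat (Suc n) *s (- (2 *s (b - a)))"
      by (simp only: linear_map_add[OF r_lin] linear_map_scale[OF r_lin] linear_map_minus[OF r_lin] r s0)
         (rule functional_eqI, simp add: functional_simps algebra_simps)
    with r_axis Suc show ?case by (metis mem_Collect_eq)
  qed
  from arith_progression_zero[OF vector_space_axioms fin this] have "2 *s (b - a) = 0" by simp
  then show ?thesis by simp
qed

end

section \<open>Generic pairs\<close>

locale generic_pair = half_algebra scale mul
  for scale :: "'k::field_char_0 \<Rightarrow> 'v::ab_group_add \<Rightarrow> 'v" (infixr "*s" 75)
    and mul :: "'v \<Rightarrow> 'v \<Rightarrow> 'v" (infixl "\<cdot>" 70) +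
  fixes a b :: 'v and c :: 'k
  assumes a: "axis a" and b: "axis b" and lam_ab: "lam a b = (c + 1) / 2"
    and c_neq: "c \<noteq> 1" "c \<noteq> - 1" "2 * c + 1 \<noteq> 0"
begin

text \<open>\<open>e\<close> is the identity of the subalgebra generated by \<open>a\<close> and \<open>b\<close>. If \<open>c\<close> is thought of as \<open>cos \<theta>\<close>,
  then \<open>p\<close> and \<open>q\<close> are unit vectors at angle \<open>\<theta>\<close> in the plane orthogonal to \<open>e\<close>.\<close>

definition e :: 'v where "e = (4 / (c - 1)) *s sigma a b"
definition p :: 'v where "p = 2 *s a - e"
definition q :: 'v where "q = 2 *s b - e"

lemma sigma_e: "sigma a b = ((c - 1) / 4) *s e"
proof -
  have "(c - 1) / 4 * (4 / (c - 1)) = 1" using c_neq by simp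
  then show ?thesis unfolding e_def by (simp only: scale_scale scale_one)
qed

lemma a_eq: "a = (1/2) *s (e + p)" and b_eq: "b = (1/2) *s (e + q)"
  by (simp_all add: p_def q_def)

lemma lam_ba: "lam b a = (c + 1) / 2"
  using lam_commute[OF a b] lam_ab by simp

lemma lam_ab': "(lam a b - 1) / 2 = (c - 1) / 4" "(lam b a - 1) / 2 = (c - 1) / 4"
  unfolding lam_ab lam_ba by (simp_all add: field_simps)

lemma mul_e: "a \<cdot> e = a" "b \<cdot> e = b" "e \<cdot> e = e"
proof -
  have k: "4 / (c - 1) * ((c - 1) / 4) = 1" using c_neq by simp
  have s: "a \<cdot> sigma a b = ((c - 1) / 4) *s a" "b \<cdot> sigma a b = ((c - 1) / 4) *s b"
    "sigma a b \<cdot> sigma a b = ((c - 1) / 4) *s sigma a b"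
    using mul_sigma[OF a, of b] mul_sigma[OF b, of a] sigma_mul_mul[OF a b]
    unfolding lam_ab' sigma_commute[of b a] by auto
  show "a \<cdot> e = a" "b \<cdot> e = b"
    unfolding e_def mul_simps s by (simp_all only: scale_scale k scale_one)
  show "e \<cdot> e = e"
    unfolding e_def mul_simps s by (simp only: scale_scale k mult_1_right mult_1_left)
qed

lemma ab: "a \<cdot> b = ((c - 1) / 4) *s e + (1/2) *s (a + b)"
  using mul_eq_sigma[of a b] by (simp only: sigma_e)

lemma e_commute:
  shows "a \<cdot> (e \<cdot> u) = e \<cdot> (a \<cdot> u)" "b \<cdot> (e \<cdot> u) = e \<cdot> (b \<cdot> u)"
    and p_e: "p \<cdot> (e \<cdot> u) = e \<cdot> (p \<cdot> u)" and q_e: "q \<cdot> (e \<cdot> u) = e \<cdot> (q \<cdot> u)"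
proof -
  show "a \<cdot> (e \<cdot> u) = e \<cdot> (a \<cdot> u)" "b \<cdot> (e \<cdot> u) = e \<cdot> (b \<cdot> u)" for u
    using seress[OF a, of e 1 u] seress[OF b, of e 1 u] by (simp_all add: mul_e)
  then show "p \<cdot> (e \<cdot> u) = e \<cdot> (p \<cdot> u)" "q \<cdot> (e \<cdot> u) = e \<cdot> (q \<cdot> u)"
    unfolding p_def q_def by (simp_all add: mul_simps)
qed

lemma pq_table:
  "e \<cdot> p = p" "e \<cdot> q = q" "p \<cdot> e = p" "q \<cdot> e = q"
  "p \<cdot> p = e" "q \<cdot> q = e" "p \<cdot> q = c *s e" "q \<cdot> p = c *s e"
proof -
  have ea: "e \<cdot> a = a" "e \<cdot> b = b" "b \<cdot> a = a \<cdot> b"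
    using mul_e by (simp_all add: mul_commute)
  note t = mul_e ea axis_idem[OF a] axis_idem[OF b] ab
  show "e \<cdot> p = p" "e \<cdot> q = q" "p \<cdot> e = p" "q \<cdot> e = q"
    by (simp_all add: p_def q_def mul_simps t)
  show "p \<cdot> p = e" "q \<cdot> q = e"
    by (rule functional_eqI; simp add: p_def q_def mul_simps t functional_simps)+
  show "p \<cdot> q = c *s e" "q \<cdot> p = c *s e"
    by (rule functional_eqI; simp add: p_def q_def mul_simps t functional_simps; simp add: field_simps)+
qed

lemma form_table:
  "form e e = 2" "form p p = 2" "form q q = 2" "form p q = 2 * c" "form q p = 2 * c"
  "form e p = 0" "form p e = 0" "form e q = 0" "form q e = 0"
proof -
  have ab: "form a a = 1" "form b b = 1" "form a b = (c + 1) / 2" "form b a = (c + 1) / 2"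
    using lam_ab lam_commute[OF a b] by (simp_all add: form_axis_left a b lam_self)
  have ae: "form a e = 1" "form b e = 1"
    using form_mul'[of a a e] form_mul'[of b b e] by (simp_all add: mul_e axis_idem a b ab)
  then have ea: "form e a = 1" "form e b = 1" by (simp_all add: form_commute)
  have "((c - 1) / 4) * form e e = form (sigma a b) e" by (simp add: sigma_e form_simps)
  also have "\<dots> = form a (b \<cdot> e) - 1"
    unfolding sigma_def form_simps form_mul' ae by simp
  also have "\<dots> = ((c - 1) / 4) * 2" by (simp add: mul_e ab field_simps)
  finally show ee: "form e e = 2" using c_neq by (subst (asm) mult_left_cancel) simp_all
  show "form p p = 2" "form q q = 2" "form p q = 2 * c" "form q p = 2 * c"
    "form e p = 0" "form p e = 0" "form e q = 0" "form q e = 0"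
    unfolding p_def q_def form_simps ab ae ea ee by (simp_all add: field_simps)
qed

lemma tau_pq:
  "tau a e = e" "tau a p = p" "tau a q = (2 * c) *s p - q"
  "tau b e = e" "tau b q = q" "tau b p = (2 * c) *s q - p"
proof -
  have k: "4 * lam a b - 2 = 2 * c" "4 * lam b a - 2 = 2 * c"
    unfolding lam_ab lam_ba by (simp_all add: field_simps)
  show e: "tau a e = e" "tau b e = e"
    using tau_sigma[OF a, of b] tau_sigma[OF b, of a]
    unfolding e_def linear_map_simps[OF linear_map_tau] by (simp_all add: sigma_commute[of b a])
  show "tau a p = p" "tau b q = q"
    unfolding p_def q_def linear_map_simps[OF linear_map_tau] e by (simp_all add: tau_self a b)
  have "tau a b = (2 * c) *s a - b - (c - 1) *s e" "tau b a = (2 * c) *s b - a - (c - 1) *s e"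
    using tau_axis_eq[OF a, of b] tau_axis_eq[OF b, of a]
    unfolding k sigma_commute[of b a] sigma_e by simp_all
  note t = this e
  show "tau a q = (2 * c) *s p - q" "tau b p = (2 * c) *s q - p"
    unfolding p_def q_def linear_map_simps[OF linear_map_tau] t
    by (rule functional_eqI, simp add: functional_simps algebra_simps)+
qed

section \<open>The orthogonal complement of e, p, q and its Clifford relations\<close>

definition W :: "'v set" where
  "W = {w. form e w = 0 \<and> form p w = 0 \<and> form q w = 0}"

lemma subspace_W: "u \<in> W \<Longrightarrow> w \<in> W \<Longrightarrow> u + w \<in> W" "w \<in> W \<Longrightarrow> r *s w \<in> W"
  "u \<in> W \<Longrightarrow> w \<in> W \<Longrightarrow> u - w \<in> W" "w \<in> W \<Longrightarrow> - w \<in> W"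
  by (auto simp: W_def form_simps)

lemma W_mul:
  assumes "w \<in> W"
  shows "e \<cdot> w \<in> W" "p \<cdot> w \<in> W" "q \<cdot> w \<in> W"
  using assms by (auto simp: W_def form_mul'[symmetric] pq_table mul_e form_simps)

lemma lam_W: "w \<in> W \<Longrightarrow> lam a w = 0" "w \<in> W \<Longrightarrow> lam b w = 0"
  using arg_cong[OF a_eq, of "\<lambda>x. form x w"] arg_cong[OF b_eq, of "\<lambda>x. form x w"]
  unfolding form_axis_left[OF a] form_axis_left[OF b] by (simp_all add: form_simps W_def)

lemma tau_W:
  assumes "w \<in> W"
  shows "tau a w = w - 2 *s (e \<cdot> w) - 2 *s (p \<cdot> w)" "tau b w = w - 2 *s (e \<cdot> w) - 2 *s (q \<cdot> w)"
  unfolding tau_axis[OF a] tau_axis[OF b] lam_W[OF assms] p_def q_def mul_simps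
  by (rule functional_eqI, simp add: functional_simps)+

text \<open>On \<open>W\<close> the coefficient \<open>lam a\<close> vanishes, so a (a w) = (a w)/2;
  now substitute a = (e + p)/2, and likewise for \<open>b\<close>.\<close>

lemma W_pp:
  assumes w: "w \<in> W"
  shows "p \<cdot> (p \<cdot> w) = p \<cdot> w - 2 *s (e \<cdot> (p \<cdot> w)) + e \<cdot> w - e \<cdot> (e \<cdot> w)"
    and "q \<cdot> (q \<cdot> w) = q \<cdot> w - 2 *s (e \<cdot> (q \<cdot> w)) + e \<cdot> w - e \<cdot> (e \<cdot> w)"
proof -
  have "a \<cdot> (a \<cdot> w) = (1/2) *s (a \<cdot> w)" "b \<cdot> (b \<cdot> w) = (1/2) *s (b \<cdot> w)"
    using axis_mul_mul[OF a, of w] axis_mul_mul[OF b, of w] lam_W[OF w] by simp_all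
  then show "p \<cdot> (p \<cdot> w) = p \<cdot> w - 2 *s (e \<cdot> (p \<cdot> w)) + e \<cdot> w - e \<cdot> (e \<cdot> w)"
    "q \<cdot> (q \<cdot> w) = q \<cdot> w - 2 *s (e \<cdot> (q \<cdot> w)) + e \<cdot> w - e \<cdot> (e \<cdot> w)"
    unfolding p_def q_def
    by (auto intro!: functional_eqI simp: mul_simps functional_simps e_commute algebra_simps)
qed

text \<open>The first form expands \<open>tau a\<close> applied to q w, the second
  \<open>tau b\<close> applied to p w. Equating them yields \<open>W_half_diff\<close>.\<close>

lemma W_anticomm:
  assumes w: "w \<in> W"
  shows "p \<cdot> (q \<cdot> w) + q \<cdot> (p \<cdot> w)
      = q \<cdot> w - 2 *s (e \<cdot> (q \<cdot> w)) + c *s (p \<cdot> w - 2 *s (e \<cdot> (p \<cdot> w))) + (2 * c) *s (e \<cdot> w - e \<cdot> (e \<cdot> w))"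
    and "p \<cdot> (q \<cdot> w) + q \<cdot> (p \<cdot> w)
      = p \<cdot> w - 2 *s (e \<cdot> (p \<cdot> w)) + c *s (q \<cdot> w - 2 *s (e \<cdot> (q \<cdot> w))) + (2 * c) *s (e \<cdot> w - e \<cdot> (e \<cdot> w))"
proof -
  have 1: "q \<cdot> w - 2 *s (e \<cdot> (q \<cdot> w)) - 2 *s (p \<cdot> (q \<cdot> w))
     = ((2 * c) *s p - q) \<cdot> (w - 2 *s (e \<cdot> w) - 2 *s (p \<cdot> w))"
    using tau_mul[OF a, of q w] by (simp only: tau_W w W_mul tau_pq)
  have 2: "p \<cdot> w - 2 *s (e \<cdot> (p \<cdot> w)) - 2 *s (q \<cdot> (p \<cdot> w))
     = ((2 * c) *s q - p) \<cdot> (w - 2 *s (e \<cdot> w) - 2 *s (q \<cdot> w))"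
    using tau_mul[OF b, of p w] by (simp only: tau_W w W_mul tau_pq)
  show "p \<cdot> (q \<cdot> w) + q \<cdot> (p \<cdot> w)
      = q \<cdot> w - 2 *s (e \<cdot> (q \<cdot> w)) + c *s (p \<cdot> w - 2 *s (e \<cdot> (p \<cdot> w))) + (2 * c) *s (e \<cdot> w - e \<cdot> (e \<cdot> w))"
    using 1 by (rule eq_by_scaling[where k = "- 1/2"])
      (simp add: mul_simps functional_simps p_e q_e W_pp(1)[OF w] field_simps)
  show "p \<cdot> (q \<cdot> w) + q \<cdot> (p \<cdot> w)
      = p \<cdot> w - 2 *s (e \<cdot> (p \<cdot> w)) + c *s (q \<cdot> w - 2 *s (e \<cdot> (q \<cdot> w))) + (2 * c) *s (e \<cdot> w - e \<cdot> (e \<cdot> w))"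
    using 2 by (rule eq_by_scaling[where k = "- 1/2"])
      (simp add: mul_simps functional_simps p_e q_e W_pp(2)[OF w] field_simps)
qed

lemma W_half_diff:
  assumes w: "w \<in> W"
  shows "q \<cdot> w - 2 *s (e \<cdot> (q \<cdot> w)) = p \<cdot> w - 2 *s (e \<cdot> (p \<cdot> w))"
proof -
  let ?P = "p \<cdot> w - 2 *s (e \<cdot> (p \<cdot> w))" and ?Q = "q \<cdot> w - 2 *s (e \<cdot> (q \<cdot> w))"
  have "?Q + c *s ?P = ?P + c *s ?Q"
    using W_anticomm[OF w] by simp
  then have "(1 - c) *s (?Q - ?P) = 0"
    by (rule eq_by_scaling[where k = 1]) (simp add: functional_simps algebra_simps)
  then show ?thesis using c_neq by simp
qed

text \<open>Let P and Q be the defects of p w and q w from being half-eigenvectors of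
  \<open>e\<close>. \<open>W_half_diff\<close> gives Q = P; the same lemma for
  \<open>tau a w\<close>, moved back by \<open>tau a\<close>, gives 2c P - Q = P. Hence 2 (c - 1) P
  = 0.\<close>

lemma W_half:
  assumes w: "w \<in> W"
  shows "e \<cdot> (p \<cdot> w) = (1/2) *s (p \<cdot> w)" "e \<cdot> (q \<cdot> w) = (1/2) *s (q \<cdot> w)"
proof -
  let ?P = "p \<cdot> w - 2 *s (e \<cdot> (p \<cdot> w))" and ?Q = "q \<cdot> w - 2 *s (e \<cdot> (q \<cdot> w))"
  have "tau a w \<in> W" using tau_W[OF w] w W_mul subspace_W by simp
  from arg_cong[OF W_half_diff[OF this], of "tau a"]
  have "((2 * c) *s p - q) \<cdot> w - 2 *s (e \<cdot> (((2 * c) *s p - q) \<cdot> w)) = ?P"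
    by (simp only: linear_map_simps[OF linear_map_tau] tau_mul[OF a] tau_pq tau_tau[OF a])
  then have "(2 * c) *s ?P - ?Q = ?P"
    by (simp add: mul_simps algebra_simps)
  then have "(2 * c) *s ?P - ?P - ?P = 0"
    unfolding W_half_diff[OF w] by simp
  moreover have "(2 * c) *s X - X - X = (2 * (c - 1)) *s X" for X
    by (rule functional_eqI) (simp add: functional_simps algebra_simps)
  ultimately have "(2 * (c - 1)) *s ?P = 0" by simp
  then have P: "?P = 0" using c_neq by simp
  then have Q: "?Q = 0" using W_half_diff[OF w] by simp
  from P have "p \<cdot> w = 2 *s (e \<cdot> (p \<cdot> w))" by simp
  then show "e \<cdot> (p \<cdot> w) = (1/2) *s (p \<cdot> w)" by (metis scale_scale scale_one nonzero_divide_eq_eq times_divide_eq_left zero_neq_numeral mult_1)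
  from Q have "q \<cdot> w = 2 *s (e \<cdot> (q \<cdot> w))" by simp
  then show "e \<cdot> (q \<cdot> w) = (1/2) *s (q \<cdot> w)" by (metis scale_scale scale_one nonzero_divide_eq_eq times_divide_eq_left zero_neq_numeral mult_1)
qed

text \<open>The Clifford relations of the plane, scaled by the operator e - e^2, which is 1/4 on
  \<open>U\<close> and 0 on \<open>Z\<close>.\<close>

lemma W_pp':
  assumes w: "w \<in> W"
  shows "p \<cdot> (p \<cdot> w) = e \<cdot> w - e \<cdot> (e \<cdot> w)" "q \<cdot> (q \<cdot> w) = e \<cdot> w - e \<cdot> (e \<cdot> w)"
    "p \<cdot> (q \<cdot> w) + q \<cdot> (p \<cdot> w) = (2 * c) *s (e \<cdot> w - e \<cdot> (e \<cdot> w))"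
  using W_pp[OF w] W_anticomm[OF w] by (simp_all add: W_half[OF w])

section \<open>Splitting the complement into a Clifford module and the annihilator of the
  plane\<close>

definition U :: "'v set" where
  "U = {u \<in> W. e \<cdot> u = (1/2) *s u}"

text \<open>Multiplication by \<open>e\<close> is idempotent here (\<open>Z_e\<close>), so
  \<open>Z\<close> gathers the eigenvalues 0 and 1 of \<open>e\<close>.\<close>

definition Z :: "'v set" where
  "Z = {z \<in> W. p \<cdot> z = 0 \<and> q \<cdot> z = 0}"

lemma subspace_U: "u \<in> U \<Longrightarrow> w \<in> U \<Longrightarrow> u + w \<in> U" "w \<in> U \<Longrightarrow> r *s w \<in> U"
  "u \<in> U \<Longrightarrow> w \<in> U \<Longrightarrow> u - w \<in> U" "w \<in> U \<Longrightarrow> - w \<in> U"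
  by (auto simp: U_def subspace_W mul_simps scale_right_distrib scale_right_diff_distrib scale_left_commute)

lemma U_mul: "w \<in> W \<Longrightarrow> p \<cdot> w \<in> U" "w \<in> W \<Longrightarrow> q \<cdot> w \<in> U"
  by (auto simp: U_def W_mul W_half)

lemma U_e: "u \<in> U \<Longrightarrow> e \<cdot> u = (1/2) *s u"
  by (simp add: U_def)

lemma UW: "u \<in> U \<Longrightarrow> u \<in> W"
  by (simp add: U_def)

lemma
  assumes u: "u \<in> U"
  shows U_pp: "p \<cdot> (p \<cdot> u) = (1/4) *s u"
    and U_qq: "q \<cdot> (q \<cdot> u) = (1/4) *s u"
    and U_qp: "q \<cdot> (p \<cdot> u) = (c / 2) *s u - p \<cdot> (q \<cdot> u)"
proof -
  have y: "e \<cdot> u - e \<cdot> (e \<cdot> u) = (1/4) *s u"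
    by (rule functional_eqI) (simp add: U_e[OF u] mul_simps functional_simps)
  show "p \<cdot> (p \<cdot> u) = (1/4) *s u" "q \<cdot> (q \<cdot> u) = (1/4) *s u"
    using W_pp'[OF UW[OF u]] y by simp_all
  have "p \<cdot> (q \<cdot> u) + q \<cdot> (p \<cdot> u) = (c / 2) *s u"
    unfolding W_pp'(3)[OF UW[OF u]] y by simp
  then show "q \<cdot> (p \<cdot> u) = (c / 2) *s u - p \<cdot> (q \<cdot> u)"
    by (metis add_diff_cancel_left')
qed

lemma Z_pq: "z \<in> Z \<Longrightarrow> p \<cdot> z = 0" "z \<in> Z \<Longrightarrow> q \<cdot> z = 0"
  by (auto simp: Z_def)

lemma Z_e: "z \<in> Z \<Longrightarrow> e \<cdot> (e \<cdot> z) = e \<cdot> z"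
  using W_pp'(1)[of z] by (simp add: Z_def)

lemma Z_mul: "z \<in> Z \<Longrightarrow> e \<cdot> z \<in> Z"
  by (auto simp: Z_def W_mul p_e q_e)

lemma subspace_Z: "z \<in> Z \<Longrightarrow> w \<in> Z \<Longrightarrow> z + w \<in> Z" "w \<in> Z \<Longrightarrow> r *s w \<in> Z"
  "z \<in> Z \<Longrightarrow> w \<in> Z \<Longrightarrow> z - w \<in> Z"
  by (auto simp: Z_def subspace_W mul_simps)

lemma decomp:
  obtains r s t z u where "y = r *s e + s *s p + t *s q + z + u" "z \<in> Z" "u \<in> U"
proof -
  \<comment> \<open>The coefficients of \<open>p\<close> and \<open>q\<close> solve the linear
    system with Gram matrix (2, 2c; 2c, 2).\<close>
  define d where "d = 2 * (1 - c) * (1 + c)"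
  have d: "d \<noteq> 0" using c_neq by (simp add: d_def eq_neg_iff_add_eq_0 add.commute)
  define r s t where "r = form e y / 2" "s = (form p y - c * form q y) / d" "t = (form q y - c * form p y) / d"
  define w where "w = y - (r *s e + s *s p + t *s q)"
  have "2 * s + 2 * c * t = form p y" "2 * c * s + 2 * t = form q y"
    unfolding r_s_t_def using d by (simp_all add: divide_simps) (simp_all add: d_def algebra_simps)
  then have w: "w \<in> W"
    unfolding W_def by (simp add: w_def form_simps form_table r_s_t_def(1)) (simp add: algebra_simps)
  \<comment> \<open>4t(1 - t) is 1 at t = 1/2 and 0 at t = 0, 1, so this is the projection of
    \<open>w\<close> to \<open>U\<close>.\<close>
  define u where "u = 4 *s (e \<cdot> w - e \<cdot> (e \<cdot> w))"
  have u: "u = 4 *s (p \<cdot> (p \<cdot> w))" "u = 4 *s (q \<cdot> (q \<cdot> w))"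
    unfolding u_def W_pp'[OF w] by simp_all
  have "u \<in> U" unfolding u(1) by (intro subspace_U U_mul W_mul w)
  moreover have "w - u \<in> Z"
  proof -
    have "p \<cdot> u = p \<cdot> w" "q \<cdot> u = q \<cdot> w"
      using u U_pp[OF U_mul(1)[OF w]] U_qq[OF U_mul(2)[OF w]] by (simp_all add: mul_simps)
    then show ?thesis
      using w \<open>u \<in> U\<close> by (auto simp: Z_def UW subspace_W mul_simps)
  qed
  moreover have "y = r *s e + s *s p + t *s q + (w - u) + u" by (simp add: w_def)
  ultimately show ?thesis using that by blast
qed

lemma decomp_induct [case_names add scale e p q Z U]:
  assumes "\<And>u v. P u \<Longrightarrow> P v \<Longrightarrow> P (u + v)" "\<And>r u. P u \<Longrightarrow> P (r *s u)" "P e" "P p" "P q"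
    "\<And>z. z \<in> Z \<Longrightarrow> P z" "\<And>u. u \<in> U \<Longrightarrow> P u"
  shows "P y"
proof -
  obtain r s t z u where "y = r *s e + s *s p + t *s q + z + u" "z \<in> Z" "u \<in> U"
    by (rule decomp)
  then show ?thesis using assms by simp
qed

subsection \<open>Products of the components\<close>

text \<open>On \<open>U\<close> the rotation \<open>tau a \<circ> tau b\<close> is Clifford multiplication by \<open>4pq\<close>. \<open>PK\<close>, \<open>PV\<close> and \<open>PU\<close> are the
  projections to the span of \<open>e\<close> and \<open>Z\<close>, to the span of \<open>p\<close> and \<open>q\<close>, and to \<open>U\<close>.\<close>

definition R :: "'v \<Rightarrow> 'v" where "R u = 4 *s (p \<cdot> (q \<cdot> u))"

lemma linear_R: "linear_map R"
  unfolding linear_map_def R_def by (simp add: mul_simps scale_right_distrib scale_left_commute)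

lemma U_R: "u \<in> U \<Longrightarrow> R u \<in> U"
  unfolding R_def by (intro subspace_U U_mul W_mul UW)

lemma U_pU: "u \<in> U \<Longrightarrow> p \<cdot> u \<in> U" and U_qU: "u \<in> U \<Longrightarrow> q \<cdot> u \<in> U"
  by (simp_all add: U_mul UW)

text \<open>By the Clifford relations R has the polynomial t^2 - 2ct + 1, with roots mu and 1/mu.
  This replaces eigenvectors from here on.\<close>

lemma R_R: "u \<in> U \<Longrightarrow> R (R u) = (2 * c) *s R u - u"
  using U_qp[of "q \<cdot> u"] U_qq[of u] U_pp[of "p \<cdot> (q \<cdot> (q \<cdot> u))"]
  by (simp add: R_def mul_simps U_qU U_pU U_pp scale_right_diff_distrib)

lemma R_fixed:
  assumes u: "u \<in> U" and Ru: "R u = u"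
  shows "u = 0"
proof -
  have "p \<cdot> u = q \<cdot> u"
    using arg_cong[OF Ru, of "mul p"] U_pp[OF U_qU[OF u]] by (simp add: R_def mul_simps)
  then have "(1/4) *s u = (c / 2) *s u - (1/4) *s u"
    using U_qp[OF u] U_qq[OF u] Ru by (simp add: R_def) (metis U_pp u)
  then have "(c - 1) *s u = 0"
    by (rule eq_by_scaling[where k = "- 2"]) (simp add: functional_simps field_simps)
  then show ?thesis using c_neq by simp
qed

lemma R_inj:
  assumes "u \<in> U" "w \<in> U" "R u = R w"
  shows "u = w"
proof -
  have "R (R u) = R (R w)" by (simp add: assms)
  then have "(2 * c) *s R u - u = (2 * c) *s R w - w" by (simp only: R_R assms(1,2))
  with assms(3) show ?thesis by simp
qed

definition rho :: "'v \<Rightarrow> 'v" where "rho y = tau a (tau b y)"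

lemma linear_rho: "linear_map rho"
  unfolding linear_map_def rho_def by (simp add: linear_map_simps[OF linear_map_tau])

lemma rho_mul: "rho (u \<cdot> v) = rho u \<cdot> rho v"
  by (simp add: rho_def tau_mul a b)

lemma tau_U: "u \<in> U \<Longrightarrow> tau a u = (- 2) *s (p \<cdot> u)" "u \<in> U \<Longrightarrow> tau b u = (- 2) *s (q \<cdot> u)"
  by (simp_all add: tau_W UW U_e)

lemma tau_Z: "z \<in> Z \<Longrightarrow> tau a z = z - 2 *s (e \<cdot> z)" "z \<in> Z \<Longrightarrow> tau b z = z - 2 *s (e \<cdot> z)"
  by (simp_all add: tau_W Z_def)

lemma rho_U: "u \<in> U \<Longrightarrow> rho u = R u"
  by (simp add: rho_def tau_U U_qU linear_map_simps[OF linear_map_tau] R_def)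

lemma rho_Z: "z \<in> Z \<Longrightarrow> rho z = z"
  using tau_tau[OF a, of z] by (simp add: rho_def tau_Z)

definition PU :: "'v \<Rightarrow> 'v" where "PU y = 4 *s (e \<cdot> y - e \<cdot> (e \<cdot> y))"

definition PV :: "'v \<Rightarrow> 'v" where
  "PV y = ((form p y - c * form q y) / (2 - 2 * c * c)) *s p + ((form q y - c * form p y) / (2 - 2 * c * c)) *s q"

definition PK :: "'v \<Rightarrow> 'v" where "PK y = y - PU y - PV y"

lemma linear_PU: "linear_map PU"
  unfolding linear_map_def PU_def
  by (auto intro!: functional_eqI simp: functional_simps mul_simps algebra_simps)

lemma linear_PV: "linear_map PV"
  unfolding linear_map_def PV_def
  by (auto intro!: functional_eqI simp: functional_simps form_simps add_divide_distrib diff_divide_distrib algebra_simps)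

lemma linear_PK: "linear_map PK"
  unfolding linear_map_def PK_def
  by (auto simp: linear_map_simps[OF linear_PU] linear_map_simps[OF linear_PV] scale_right_diff_distrib)

lemma PU_eq: "PU e = 0" "PU p = 0" "PU q = 0" "z \<in> Z \<Longrightarrow> PU z = 0" "u \<in> U \<Longrightarrow> PU u = u"
proof -
  show "PU u = u" if u: "u \<in> U"
    unfolding PU_def by (rule functional_eqI) (simp add: U_e[OF u] mul_simps functional_simps)
qed (simp_all add: PU_def mul_e pq_table Z_e)

lemma U_form: "u \<in> U \<Longrightarrow> form p u = 0" "u \<in> U \<Longrightarrow> form q u = 0"
  by (auto simp: U_def W_def)

lemma Z_form: "u \<in> Z \<Longrightarrow> form p u = 0" "u \<in> Z \<Longrightarrow> form q u = 0"
  by (auto simp: Z_def W_def)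

lemma PV_det: "2 - 2 * c * c \<noteq> 0"
proof -
  have "2 - 2 * c * c = 2 * (1 - c) * (1 + c)" by (simp add: algebra_simps)
  with c_neq show ?thesis by (simp add: eq_neg_iff_add_eq_0 add.commute)
qed

lemma PV_eq: "PV e = 0" "PV p = p" "PV q = q" "z \<in> Z \<Longrightarrow> PV z = 0" "u \<in> U \<Longrightarrow> PV u = 0"
  using PV_det mult.left_commute[of c 2 c]
  by (simp_all only: PV_def form_table U_form Z_form) (simp_all add: mult.assoc)

lemma PK_eq: "PK e = e" "PK p = 0" "PK q = 0" "z \<in> Z \<Longrightarrow> PK z = z" "u \<in> U \<Longrightarrow> PK u = 0"
  by (simp_all add: PK_def PU_eq PV_eq)

lemma zero_U: "0 \<in> U"
  by (simp add: U_def W_def form_simps)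

lemma PU_in_U: "PU y \<in> U"
  by (induction y rule: decomp_induct)
     (simp_all add: PU_eq linear_map_simps[OF linear_PU] subspace_U zero_U)

lemma PU_rho: "PU (rho y) = R (PU y)"
  by (induction y rule: decomp_induct)
     (simp_all add: linear_map_simps[OF linear_PU] linear_map_simps[OF linear_rho] linear_map_simps[OF linear_R]
        PU_eq rho_U rho_Z U_R, simp_all add: rho_def tau_pq linear_map_simps[OF linear_map_tau] linear_map_simps[OF linear_PU] PU_eq)

text \<open>Both involutions fix \<open>e\<close> and act on \<open>Z\<close> as 1 - 2e, so they
  agree on the image of \<open>PK\<close>; hence the rotation acts trivially there.\<close>

lemma PK_tau: "PK (tau a y) = tau a (PK y)" "PK (tau b y) = tau a (PK y)"
  by (induction y rule: decomp_induct)
     (simp_all add: linear_map_simps[OF linear_PK] linear_map_simps[OF linear_map_tau] tau_pq PK_eq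
        tau_Z Z_mul tau_U U_pU U_qU)

lemma PK_rho: "PK (rho y) = PK y"
  by (simp add: rho_def PK_tau tau_tau[OF a])

lemma PK_PK: "PK (PK y) = PK y" "PK (PV y) = 0" "PU (PV y) = 0"
  by (induction y rule: decomp_induct)
     (simp_all add: linear_map_simps[OF linear_PK] linear_map_simps[OF linear_PV] linear_map_simps[OF linear_PU] PK_eq PV_eq PU_eq)

lemma PU_PK: "PU (PK y) = 0"
  by (induction y rule: decomp_induct)
     (simp_all add: linear_map_simps[OF linear_PK] linear_map_simps[OF linear_PU] PK_eq PU_eq)

lemma form_PK: "form p (PK y) = 0" "form q (PK y) = 0"
  by (induction y rule: decomp_induct)
     (simp_all add: linear_map_simps[OF linear_PK] form_simps PK_eq form_table Z_form)

lemma form_PV: "form p (PV y) = form p y" "form q (PV y) = form q y"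
  by (induction y rule: decomp_induct)
     (simp_all add: linear_map_simps[OF linear_PV] form_simps PV_eq form_table Z_form U_form)

lemma components: "y = PK y + PV y + PU y"
  by (simp add: PK_def)

lemma eq_zeroI:
  assumes "PU y = 0" "PK y = 0" "form p y = 0" "form q y = 0"
  shows "y = 0"
proof -
  have "PV y = 0" by (simp add: PV_def assms)
  with components[of y] assms show ?thesis by simp
qed

lemma form_prod_left: "form v (u \<cdot> w) = form (v \<cdot> u) w"
  by (simp add: form_mul')

text \<open>\<open>rho\<close> fixes \<open>z\<close>, so z u satisfies the quadratic relation of
  \<open>u\<close>. On the \<open>PK\<close> part, where \<open>rho\<close> is trivial, this reads
  (2 - 2c) PK = 0. The \<open>PV\<close> part vanishes by associativity of the form, since p z = q z
  = 0.\<close>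

lemma Z_U:
  assumes z: "z \<in> Z" and u: "u \<in> U"
  shows "z \<cdot> u \<in> U"
proof -
  let ?y = "z \<cdot> u"
  have "rho (rho ?y) = (2 * c) *s rho ?y - ?y"
    by (simp add: rho_mul rho_Z z rho_U u U_R R_R mul_simps)
  then have "PK (rho (rho ?y)) = PK ((2 * c) *s rho ?y - ?y)" by simp
  then have "PK ?y = (2 * c) *s PK ?y - PK ?y"
    by (simp only: PK_rho linear_map_simps[OF linear_PK])
  then have "(c - 1) *s PK ?y = 0"
    by (rule eq_by_scaling[where k = "- 1/2"]) (simp add: functional_simps field_simps)
  then have "PK ?y = 0" using c_neq by simp
  moreover have "PV ?y = 0"
    using z by (simp add: PV_def form_prod_left Z_pq form_simps)
  ultimately show ?thesis using components[of ?y] PU_in_U[of ?y] by simp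
qed

text \<open>The product is fixed by \<open>rho\<close>, while R has no nonzero fixed vector in
  \<open>U\<close>.\<close>

lemma Z_Z:
  assumes z: "z \<in> Z" and w: "w \<in> Z"
  shows "PK (z \<cdot> w) = z \<cdot> w"
proof -
  let ?y = "z \<cdot> w"
  have "R (PU ?y) = PU ?y"
    using PU_rho[of ?y] by (simp add: rho_mul rho_Z z w)
  then have "PU ?y = 0" using R_fixed PU_in_U by blast
  moreover have "PV ?y = 0"
    using z by (simp add: PV_def form_prod_left Z_pq form_simps)
  ultimately show ?thesis using components[of ?y] by simp
qed

text \<open>R extended to products in the manner of a derivation: for eigenvectors with eigenvalues
  mu^i and mu^j it multiplies u w by mu^i + mu^j, whereas \<open>rho\<close> multiplies it by
  mu^(i+j). \<open>rho_twist\<close> states the resulting relation without eigenvectors.\<close>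

definition twist :: "'v \<Rightarrow> 'v \<Rightarrow> 'v" where "twist u w = u \<cdot> R w + R u \<cdot> w"

lemma rho_twist:
  assumes u: "u \<in> U" and w: "w \<in> U"
  shows "rho (twist u w) + twist u w = (4 * c) *s rho (u \<cdot> w)"
  unfolding twist_def linear_map_simps[OF linear_rho] rho_mul rho_U[OF u] rho_U[OF w]
    rho_U[OF U_R[OF u]] rho_U[OF U_R[OF w]] R_R[OF u] R_R[OF w]
  by (rule functional_eqI) (simp add: functional_simps mul_simps algebra_simps)

lemma PK_twist:
  assumes u: "u \<in> U" and w: "w \<in> U"
  shows "PK (twist u w) = (2 * c) *s PK (u \<cdot> w)"
proof -
  have "PK (rho (twist u w) + twist u w) = PK ((4 * c) *s rho (u \<cdot> w))"
    by (simp only: rho_twist[OF u w])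
  then have "PK (twist u w) + PK (twist u w) = (4 * c) *s PK (u \<cdot> w)"
    by (simp only: linear_map_simps[OF linear_PK] PK_rho)
  then show ?thesis
    by (rule eq_by_scaling[where k = "1/2"]) (simp add: functional_simps field_simps)
qed

text \<open>On \<open>U\<close> one has (R + 1)^2 = 2 (c + 1) R. Applying R + 1 to R m + m = 4c R x
  and cancelling R therefore isolates m.\<close>

lemma PU_twist:
  assumes u: "u \<in> U" and w: "w \<in> U"
  shows "(c + 1) *s PU (twist u w) = (2 * c) *s (R (PU (u \<cdot> w)) + PU (u \<cdot> w))"
proof (rule R_inj)
  let ?m = "PU (twist u w)" and ?x = "PU (u \<cdot> w)"
  have m: "?m \<in> U" "?x \<in> U" by (simp_all add: PU_in_U)
  have "PU (rho (twist u w) + twist u w) = PU ((4 * c) *s rho (u \<cdot> w))"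
    by (simp only: rho_twist[OF u w])
  then have "R ?m + ?m = (4 * c) *s R ?x"
    by (simp only: linear_map_simps[OF linear_PU] PU_rho)
  then have "R (R ?m + ?m) + (R ?m + ?m) = R ((4 * c) *s R ?x) + (4 * c) *s R ?x"
    by simp
  then have *: "(2 * c) *s R ?m - ?m + R ?m + (R ?m + ?m) = (4 * c) *s R (R ?x) + (4 * c) *s R ?x"
    by (simp only: linear_map_simps[OF linear_R] R_R[OF m(1)])
  show "R ((c + 1) *s ?m) = R ((2 * c) *s (R ?x + ?x))"
    using * by (rule eq_by_scaling[where k = "1/2"])
      (simp add: functional_simps linear_map_simps[OF linear_R] field_simps)
qed (intro subspace_U PU_in_U U_R)+

text \<open>Comparing the two ways of applying the twist relation twice leaves the factor
  \<open>(2c + 1)(c - 1)\<close>; this is the only place where \<open>lam a b \<noteq> 1/4\<close> is needed.\<close>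

lemma PU_U_U:
  assumes u: "u \<in> U" and w: "w \<in> U"
  shows "PU (u \<cdot> w) = 0"
proof -
  let ?x = "PU (u \<cdot> w)" and ?m = "PU (twist u w)"
  have x: "?x \<in> U" by (rule PU_in_U)
  have 1: "(c + 1) *s ?m = (2 * c) *s (R ?x + ?x)" by (rule PU_twist[OF u w])
  \<comment> \<open>Twisting twice: R^2 = 2cR - 1 rewrites the outer terms, and the mixed term R u R
    w is \<open>rho (u \<cdot> w)\<close>.\<close>
  have "twist u (R w) + twist (R u) w = (2 * c) *s twist u w - 2 *s (u \<cdot> w) + 2 *s rho (u \<cdot> w)"
    unfolding twist_def R_R[OF u] R_R[OF w] rho_mul rho_U[OF u] rho_U[OF w]
    by (rule functional_eqI) (simp add: functional_simps mul_simps algebra_simps)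
  then have "PU (twist u (R w)) + PU (twist (R u) w) = (2 * c) *s ?m - 2 *s ?x + 2 *s R ?x"
    by (metis (no_types, lifting) linear_map_simps[OF linear_PU] PU_rho)
  then have "(c + 1) *s ((2 * c) *s ?m - 2 *s ?x + 2 *s R ?x)
     = (c + 1) *s PU (twist u (R w)) + (c + 1) *s PU (twist (R u) w)"
    by (metis scale_right_distrib)
  also have "\<dots> = (2 * c) *s (R ?m + ?m)"
    unfolding PU_twist[OF u U_R[OF w]] PU_twist[OF U_R[OF u] w]
    unfolding twist_def linear_map_simps[OF linear_PU] linear_map_simps[OF linear_R]
    by (rule functional_eqI) (simp add: functional_simps algebra_simps)
  finally have "(c + 1) *s ((c + 1) *s ((2 * c) *s ?m - 2 *s ?x + 2 *s R ?x))
    = (c + 1) *s ((2 * c) *s (R ?m + ?m))" by simp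
  then have "(c + 1) *s ((2 * c) *s ((c + 1) *s ?m)) + (c + 1) *s ((c + 1) *s (2 *s R ?x - 2 *s ?x))
    = (2 * c) *s (R ((c + 1) *s ?m) + (c + 1) *s ?m)"
    by (rule eq_by_scaling[where k = 1]) (simp add: functional_simps linear_map_simps[OF linear_R] algebra_simps)
  then have "(c + 1) *s ((2 * c) *s ((2 * c) *s (R ?x + ?x))) + (c + 1) *s ((c + 1) *s (2 *s R ?x - 2 *s ?x))
    = (2 * c) *s ((2 * c) *s ((2 * c) *s R ?x - ?x + R ?x) + (2 * c) *s (R ?x + ?x))"
    unfolding 1 by (simp only: linear_map_simps[OF linear_R] R_R[OF x])
  then have "((2 * c + 1) * (c - 1) * (c + 1)) *s (R ?x - ?x) = 0"
    by (rule eq_by_scaling[where k = "- 1/2"]) (simp add: functional_simps field_simps)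
  moreover have "(2 * c + 1) * (c - 1) * (c + 1) \<noteq> 0"
    using c_neq by (simp add: eq_neg_iff_add_eq_0)
  ultimately have "R ?x = ?x" by simp
  then show ?thesis by (rule R_fixed[OF x])
qed

text \<open>Supplies the coefficient of \<beta>\<gamma> in 4 (v u) (v w) for v = \<beta> p +
  \<gamma> q; the coefficients of the squares are \<open>tau a (u \<cdot> w)\<close> and
  \<open>tau b (u \<cdot> w)\<close>. Both sides are compared componentwise: \<open>PU_U_U\<close>
  for \<open>U\<close>, twisting for \<open>PK\<close>, the form for the plane.\<close>

lemma U_U_cross:
  assumes u: "u \<in> U" and w: "w \<in> U"
  defines "y \<equiv> u \<cdot> w"
  shows "4 *s ((p \<cdot> u) \<cdot> (q \<cdot> w) + (q \<cdot> u) \<cdot> (p \<cdot> w))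
    = (2 * c) *s tau a (PK y) + form p y *s q + form q y *s p - (2 * c) *s PV y"
    (is "4 *s ?C = ?r")
proof -
  note U = u w U_pU U_qU
  have move: "form (v \<cdot> u) w = form v y" "form u (v \<cdot> w) = form v y" for v
    by (simp_all only: y_def form_prod_left mul_commute[of u v])
  have p1: "form p ((p \<cdot> u) \<cdot> (q \<cdot> w)) = form q y / 4"
    unfolding form_prod_left[of p] U_pp[OF u] by (simp add: form_simps move)
  have p2: "form p ((p \<cdot> w) \<cdot> (q \<cdot> u)) = form q y / 4"
    unfolding form_prod_left[of p] U_pp[OF w] form_commute[of _ "q \<cdot> u"] by (simp add: form_simps move)
  have pC: "form p ?C = form q y / 2"
    unfolding form_simps mul_commute[of "q \<cdot> u"] p1 p2 by (simp add: field_simps)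
  have q1: "form q ((q \<cdot> u) \<cdot> (p \<cdot> w)) = form p y / 4"
    unfolding form_prod_left[of q] U_qq[OF u] by (simp add: form_simps move)
  have q2: "form q ((q \<cdot> w) \<cdot> (p \<cdot> u)) = form p y / 4"
    unfolding form_prod_left[of q] U_qq[OF w] form_commute[of _ "p \<cdot> u"] by (simp add: form_simps move)
  have qC: "form q ?C = form p y / 2"
    unfolding form_simps mul_commute[of "p \<cdot> u"] q1 q2 by (simp add: field_simps)
  \<comment> \<open>\<open>tau a\<close> maps p u to -u/2 and q w to -(R w)/2.\<close>
  have "tau a (4 *s ?C) = twist u w"
    unfolding linear_map_simps[OF linear_map_tau] tau_mul[OF a, of "p \<cdot> u"] tau_mul[OF a, of "q \<cdot> u"]
      tau_U(1)[OF U_pU[OF u]] tau_U(1)[OF U_pU[OF w]] tau_U(1)[OF U_qU[OF u]] tau_U(1)[OF U_qU[OF w]]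
      U_pp[OF u] U_pp[OF w] twist_def R_def
    by (rule functional_eqI) (simp add: functional_simps mul_simps)
  then have "4 *s ?C = tau a (twist u w)"
    using tau_tau[OF a] by metis
  then have PKC: "PK (4 *s ?C) = (2 * c) *s tau a (PK y)"
    by (simp add: PK_tau PK_twist u w y_def linear_map_simps[OF linear_map_tau])
  have PUC: "PU (4 *s ?C) = 0"
    using PU_U_U U by (simp add: linear_map_simps[OF linear_PU])
  have PKr: "PK ?r = (2 * c) *s tau a (PK y)"
    by (simp add: linear_map_simps[OF linear_PK] PK_tau PK_PK PK_eq)
  have tPK: "tau a (PK y) = PK (tau a y)" by (simp add: PK_tau)
  have PUr: "PU ?r = 0"
    unfolding tPK by (simp add: linear_map_simps[OF linear_PU] PU_eq PU_PK PK_PK)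
  have C: "form p (4 *s ?C) = 2 * form q y" "form q (4 *s ?C) = 2 * form p y"
    unfolding form_simps(2) pC qC by simp_all
  have "4 *s ?C - ?r = 0"
  proof (rule eq_zeroI)
    show "PU (4 *s ?C - ?r) = 0" "PK (4 *s ?C - ?r) = 0"
      by (simp_all only: linear_map_diff[OF linear_PU, of "4 *s ?C" ?r] linear_map_diff[OF linear_PK, of "4 *s ?C" ?r] PUC PUr PKC PKr diff_self)
    show "form p (4 *s ?C - ?r) = 0" "form q (4 *s ?C - ?r) = 0"
      unfolding tPK form_simps(5) C
      by (simp_all add: form_simps form_PK form_PV form_table)
  qed
  then show ?thesis by simp
qed

lemma tau_components:
  assumes "PU y = 0"
  shows "tau a y = tau a (PK y) + form p y *s p - PV y" "tau b y = tau a (PK y) + form q y *s q - PV y"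
proof -
  have y: "y = PK y + PV y" using components[of y] assms by simp
  \<comment> \<open>The coordinates in \<open>PV\<close> come from the inverse Gram matrix;
    multiplying by the Gram matrix recovers the form values.\<close>
  have k: "(r - c * s) / (2 - 2 * c * c) * 2 + (s - c * r) / (2 - 2 * c * c) * (2 * c) = r" for r s
  proof -
    have "(r - c * s) / (2 - 2 * c * c) * 2 + (s - c * r) / (2 - 2 * c * c) * (2 * c)
      = (r * (2 - 2 * c * c)) / (2 - 2 * c * c)"
      unfolding times_divide_eq_left add_divide_distrib[symmetric]
      by (rule arg_cong[of _ _ "\<lambda>t. t / (2 - 2 * c * c)"]) (simp add: algebra_simps)
    then show ?thesis using PV_det by simp
  qed
  define s t where "s = (form p y - c * form q y) / (2 - 2 * c * c)" "t = (form q y - c * form p y) / (2 - 2 * c * c)"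
  have st: "PV y = s *s p + t *s q" "form p y = s * 2 + t * (2 * c)" "form q y = t * 2 + s * (2 * c)"
    unfolding PV_def s_t_def k by simp_all
  have "tau a (PV y) = form p y *s p - PV y" "tau b (PV y) = form q y *s q - PV y"
    unfolding st linear_map_simps[OF linear_map_tau] tau_pq
    by (rule functional_eqI, simp add: functional_simps algebra_simps)+
  moreover have "tau b (PK y) = tau a (PK y)"
    by (induction y rule: decomp_induct)
       (simp_all add: linear_map_simps[OF linear_PK] linear_map_simps[OF linear_map_tau] PK_eq tau_pq tau_Z)
  ultimately show "tau a y = tau a (PK y) + form p y *s p - PV y" "tau b y = tau a (PK y) + form q y *s q - PV y"
    using arg_cong[OF y, of "tau a"] arg_cong[OF y, of "tau b"]
    by (simp_all add: linear_map_add[OF linear_map_tau])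
qed

end

section \<open>Reflections in the points of the conic\<close>

text \<open>The equation \<open>unit\<close> says that \<beta> p + \<gamma> q has form value 2 with
  itself, as \<open>p\<close> and \<open>q\<close> do, so that the idempotent \<open>x\<close> has
  the same shape as a = (e + p)/2.\<close>

locale unit_vector = generic_pair scale mul a b c
  for scale :: "'k::field_char_0 \<Rightarrow> 'v::ab_group_add \<Rightarrow> 'v" (infixr "*s" 75)
    and mul :: "'v \<Rightarrow> 'v \<Rightarrow> 'v" (infixl "\<cdot>" 70) and a b c +
  fixes \<beta> \<gamma> :: 'k
  assumes unit: "\<beta> * \<beta> + \<gamma> * \<gamma> + 2 * c * \<beta> * \<gamma> = 1"
begin

definition v :: 'v where "v = \<beta> *s p + \<gamma> *s q"

definition x :: 'v where "x = (1/2) *s (e + v)"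

lemma v_mul: "v \<cdot> p = (\<beta> + c * \<gamma>) *s e" "v \<cdot> q = (c * \<beta> + \<gamma>) *s e" "v \<cdot> v = e"
  "e \<cdot> v = v" "v \<cdot> e = v" "p \<cdot> v = (\<beta> + c * \<gamma>) *s e" "q \<cdot> v = (c * \<beta> + \<gamma>) *s e"
proof -
  show 1: "v \<cdot> p = (\<beta> + c * \<gamma>) *s e" "v \<cdot> q = (c * \<beta> + \<gamma>) *s e" "e \<cdot> v = v" "v \<cdot> e = v"
    "p \<cdot> v = (\<beta> + c * \<gamma>) *s e" "q \<cdot> v = (c * \<beta> + \<gamma>) *s e"
    by (simp_all add: v_def mul_simps pq_table scale_left_distrib mult.commute)
  have "v \<cdot> v = \<beta> *s (v \<cdot> p) + \<gamma> *s (v \<cdot> q)" by (simp add: v_def mul_simps)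
  also have "\<dots> = (\<beta> * \<beta> + \<gamma> * \<gamma> + 2 * c * \<beta> * \<gamma>) *s e"
    unfolding 1 by (rule functional_eqI) (simp add: functional_simps algebra_simps)
  finally show "v \<cdot> v = e" by (simp add: unit)
qed

lemma v_U: "u \<in> U \<Longrightarrow> v \<cdot> u \<in> U" and v_Z: "z \<in> Z \<Longrightarrow> v \<cdot> z = 0"
  by (simp_all add: v_def mul_simps subspace_U U_pU U_qU Z_pq)

lemma v_v_U:
  assumes u: "u \<in> U"
  shows "v \<cdot> (v \<cdot> u) = (1/4) *s u"
    and "v \<cdot> (p \<cdot> u) = ((\<beta> + c * \<gamma>) / 2) *s u - p \<cdot> (v \<cdot> u)"
    and "v \<cdot> (q \<cdot> u) = ((c * \<beta> + \<gamma>) / 2) *s u - q \<cdot> (v \<cdot> u)"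
proof -
  show 1: "v \<cdot> (p \<cdot> u) = ((\<beta> + c * \<gamma>) / 2) *s u - p \<cdot> (v \<cdot> u)"
    "v \<cdot> (q \<cdot> u) = ((c * \<beta> + \<gamma>) / 2) *s u - q \<cdot> (v \<cdot> u)"
    unfolding v_def by (rule functional_eqI, simp add: mul_simps functional_simps U_pp u U_qq U_qp field_simps)+
  have "v \<cdot> (v \<cdot> u) = ((\<beta> * \<beta> + \<gamma> * \<gamma> + 2 * c * \<beta> * \<gamma>) / 4) *s u"
    unfolding v_def by (rule functional_eqI) (simp add: mul_simps functional_simps U_pp u U_qq U_qp field_simps)
  then show "v \<cdot> (v \<cdot> u) = (1/4) *s u" by (simp add: unit)
qed

lemma tau_x_e: "tau x e = e"
proof -
  have "x \<cdot> e = x" by (simp add: x_def mul_simps mul_e v_mul)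
  moreover have "x \<cdot> x = x"
    by (rule functional_eqI) (simp add: x_def mul_simps functional_simps mul_e v_mul add_divide_distrib)
  ultimately show ?thesis by (simp add: tau_def)
qed

lemma tau_x_V:
  assumes "v \<cdot> w = h *s e" "e \<cdot> w = w"
  shows "tau x w = (2 * h) *s v - w"
  unfolding tau_def x_def
  by (rule functional_eqI) (simp add: mul_simps functional_simps assms mul_e v_mul field_simps)

lemma tau_x_pq: "tau x p = (2 * (\<beta> + c * \<gamma>)) *s v - p" "tau x q = (2 * (c * \<beta> + \<gamma>)) *s v - q"
  using tau_x_V[OF v_mul(1)] tau_x_V[OF v_mul(2)] by (simp_all add: pq_table)

lemma tau_x_Z:
  assumes z: "z \<in> Z"
  shows "tau x z = tau a z"
proof -
  have "tau x z = z - 2 *s (e \<cdot> z)"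
    unfolding tau_def x_def
    by (rule functional_eqI) (simp add: z mul_simps functional_simps v_Z Z_mul Z_e)
  then show ?thesis by (simp add: tau_Z z)
qed

lemma tau_x_U: "u \<in> U \<Longrightarrow> tau x u = (- 2) *s (v \<cdot> u)"
  unfolding tau_def x_def
  by (rule functional_eqI)
     (simp add: mul_simps functional_simps U_e v_U v_v_U field_simps)

lemma tau_x_PK: "tau x (PK y) = tau a (PK y)"
  by (induction y rule: decomp_induct)
     (simp_all add: linear_map_simps[OF linear_PK] linear_map_simps[OF linear_map_tau] PK_eq tau_pq tau_x_e tau_x_Z)

lemma tau_x_tau_x: "tau x (tau x y) = y"
proof (induction y rule: decomp_induct)
  case (Z z)
  then have "tau a z \<in> Z" by (simp add: tau_Z subspace_Z Z_mul)
  with Z show ?case by (simp add: tau_x_Z tau_tau[OF a])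
next
  case (U u)
  then show ?case by (simp add: tau_x_U v_U v_v_U linear_map_simps[OF linear_map_tau])
next
  case p
  have "tau x v = v" by (rule functional_eqI) (simp add: tau_x_V[of v 1] v_mul functional_simps)
  then show ?case by (simp add: tau_x_pq linear_map_simps[OF linear_map_tau])
next
  case q
  have "tau x v = v" by (rule functional_eqI) (simp add: tau_x_V[of v 1] v_mul functional_simps)
  then show ?case by (simp add: tau_x_pq linear_map_simps[OF linear_map_tau])
qed (simp_all add: linear_map_simps[OF linear_map_tau] tau_x_e)

lemma tau_x_mul_e: "tau x (e \<cdot> y) = e \<cdot> tau x y"
proof -
  have "x \<cdot> (e \<cdot> y) = e \<cdot> (x \<cdot> y)" for y
    by (simp add: x_def v_def mul_simps p_e q_e)
  then show ?thesis by (simp add: tau_def mul_simps)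
qed

lemma tau_x_mul_p: "tau x (p \<cdot> y) = tau x p \<cdot> tau x y"
proof (induction y rule: decomp_induct)
  case (Z z)
  then show ?case
    by (simp add: tau_x_pq tau_x_Z tau_Z Z_pq Z_mul v_Z mul_simps linear_map_simps[OF linear_map_tau])
next
  case (U u)
  show ?case
    unfolding tau_x_pq tau_x_U[OF U] tau_x_U[OF U_pU[OF U]] v_v_U[OF U] mul_simps
    by (rule functional_eqI) (simp add: functional_simps mul_simps v_v_U[OF U] field_simps)
next
  case p
  show ?case
    by (rule functional_eqI)
       (simp add: functional_simps linear_map_simps[OF linear_map_tau] mul_simps pq_table tau_x_e tau_x_pq v_mul algebra_simps)
next
  case q
  show ?case
    by (rule functional_eqI)
       (simp add: functional_simps linear_map_simps[OF linear_map_tau] mul_simps pq_table tau_x_e tau_x_pq v_mul algebra_simps)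
qed (simp_all add: linear_map_simps[OF linear_map_tau] mul_simps pq_table tau_x_e tau_x_pq v_mul)

lemma tau_x_mul_q: "tau x (q \<cdot> y) = tau x q \<cdot> tau x y"
proof (induction y rule: decomp_induct)
  case (Z z)
  then show ?case
    by (simp add: tau_x_pq tau_x_Z tau_Z Z_pq Z_mul v_Z mul_simps linear_map_simps[OF linear_map_tau])
next
  case (U u)
  show ?case
    unfolding tau_x_pq tau_x_U[OF U] tau_x_U[OF U_qU[OF U]] v_v_U[OF U] mul_simps
    by (rule functional_eqI) (simp add: functional_simps mul_simps v_v_U[OF U] field_simps)
next
  case p
  show ?case
    by (rule functional_eqI)
       (simp add: functional_simps linear_map_simps[OF linear_map_tau] mul_simps pq_table tau_x_e tau_x_pq v_mul algebra_simps)
next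
  case q
  show ?case
    by (rule functional_eqI)
       (simp add: functional_simps linear_map_simps[OF linear_map_tau] mul_simps pq_table tau_x_e tau_x_pq v_mul algebra_simps)
qed (simp_all add: linear_map_simps[OF linear_map_tau] mul_simps pq_table tau_x_e tau_x_pq v_mul)

text \<open>Linear in v: multiplicativity of \<open>tau a\<close> and \<open>tau b\<close> gives the
  claim for \<open>p\<close> and \<open>q\<close> with the same factor \<open>tau a z\<close>,
  because the two involutions agree on \<open>Z\<close>.\<close>

lemma tau_x_mul_Z_U:
  assumes z: "z \<in> Z" and u: "u \<in> U"
  shows "tau x (z \<cdot> u) = tau x z \<cdot> tau x u"
proof -
  have p: "p \<cdot> (z \<cdot> u) = tau a z \<cdot> (p \<cdot> u)" and q: "q \<cdot> (z \<cdot> u) = tau a z \<cdot> (q \<cdot> u)"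
    using tau_mul[OF a, of z u] tau_mul[OF b, of z u]
    by (simp_all add: tau_U Z_U z u mul_simps tau_Z)
  show ?thesis
    unfolding tau_x_U[OF Z_U[OF z u]] tau_x_U[OF u] tau_x_Z[OF z]
    by (simp add: v_def mul_simps p q)
qed

text \<open>Quadratic in (\<beta>, \<gamma>): the three coefficients are known from
  \<open>tau a\<close>, \<open>tau b\<close> and \<open>U_U_cross\<close>, and \<open>unit\<close>
  turns the common factor of \<open>tau a (PK y) - PV y\<close> into 1.\<close>

lemma tau_x_mul_U_U:
  assumes u: "u \<in> U" and w: "w \<in> U"
  shows "tau x (u \<cdot> w) = tau x u \<cdot> tau x w"
proof -
  define y where "y = u \<cdot> w"
  have PU: "PU y = 0" by (simp add: y_def PU_U_U u w)
  have pp: "4 *s ((p \<cdot> u) \<cdot> (p \<cdot> w)) = tau a (PK y) + form p y *s p - PV y"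
    using tau_mul[OF a, of u w] tau_components(1)[OF PU] by (simp add: tau_U u w mul_simps y_def)
  have qq: "4 *s ((q \<cdot> u) \<cdot> (q \<cdot> w)) = tau a (PK y) + form q y *s q - PV y"
    using tau_mul[OF b, of u w] tau_components(2)[OF PU] by (simp add: tau_U u w mul_simps y_def)
  note pq = U_U_cross[OF u w, folded y_def]
  have "tau x u \<cdot> tau x w = (\<beta> * \<beta>) *s (4 *s ((p \<cdot> u) \<cdot> (p \<cdot> w))) + (\<gamma> * \<gamma>) *s (4 *s ((q \<cdot> u) \<cdot> (q \<cdot> w)))
      + (\<beta> * \<gamma>) *s (4 *s ((p \<cdot> u) \<cdot> (q \<cdot> w) + (q \<cdot> u) \<cdot> (p \<cdot> w)))"
    unfolding tau_x_U[OF u] tau_x_U[OF w] v_def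
    by (rule functional_eqI) (simp add: functional_simps mul_simps algebra_simps)
  also have "\<dots> = (\<beta> * \<beta> + \<gamma> * \<gamma> + 2 * c * \<beta> * \<gamma>) *s (tau a (PK y) - PV y) + form v y *s v"
    unfolding pp qq pq v_def
    by (rule functional_eqI) (simp add: functional_simps form_simps algebra_simps)
  also have "\<dots> = tau x (PK y) + (form v y *s v - PV y)"
    unfolding unit tau_x_PK by simp
  also have "form v y *s v - PV y = tau x (PV y)"
  proof -
    have f: "form v y = form v (PV y)" by (simp add: v_def form_simps form_PV)
    have "form v p = 2 * (\<beta> + c * \<gamma>)" "form v q = 2 * (c * \<beta> + \<gamma>)"
      by (simp_all add: v_def form_simps form_table algebra_simps)
    then have "v \<cdot> p = (form v p / 2) *s e" "v \<cdot> q = (form v q / 2) *s e"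
      by (simp_all only: v_mul(1,2)) simp_all
    then have "v \<cdot> PV y = (form v (PV y) / 2) *s e" "e \<cdot> PV y = PV y"
      unfolding PV_def mul_simps pq_table form_simps
      by (simp_all add: scale_left_distrib add_divide_distrib)
    from tau_x_V[OF this] show ?thesis by (simp add: f)
  qed
  also have "tau x (PK y) + tau x (PV y) = tau x y"
    using components[of y] PU by (metis add.right_neutral linear_map_add[OF linear_map_tau])
  finally show ?thesis by (simp add: y_def)
qed

lemma tau_x_mul: "tau x (y \<cdot> w) = tau x y \<cdot> tau x w"
proof (induction y rule: decomp_induct)
  case (Z z)
  note z = this
  show ?case
  proof (induction w rule: decomp_induct)
    case (Z w)
    have "tau x (z \<cdot> w) = tau a (z \<cdot> w)" using tau_x_PK[of "z \<cdot> w"] Z_Z[OF z Z] by simp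
    then show ?case by (simp add: tau_mul[OF a] tau_x_Z z Z)
  qed (use tau_x_mul_e[of z] tau_x_mul_p[of z] tau_x_mul_q[of z] tau_x_mul_Z_U[OF z] in
       \<open>simp_all add: linear_map_simps[OF linear_map_tau] mul_simps mul_commute[of z] mul_commute[of "tau x z"] tau_x_e\<close>)
next
  case (U u)
  note u = this
  show ?case
  proof (induction w rule: decomp_induct)
    case (Z w)
    from tau_x_mul_Z_U[OF Z u] show ?case by (simp add: mul_commute)
  qed (use tau_x_mul_e[of u] tau_x_mul_p[of u] tau_x_mul_q[of u] tau_x_mul_U_U[OF u] in
       \<open>simp_all add: linear_map_simps[OF linear_map_tau] mul_simps mul_commute[of u] mul_commute[of "tau x u"] tau_x_e\<close>)
qed (simp_all add: linear_map_simps[OF linear_map_tau] mul_simps tau_x_mul_e tau_x_mul_p tau_x_mul_q tau_x_e)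

lemma automorphism_tau_x: "automorphism (tau x)"
  unfolding automorphism_def
  by (intro conjI linear_map_tau allI tau_x_mul o_bij[of "tau x"]) (auto simp: tau_x_tau_x)

text \<open>The value of \<open>lam a\<close> is the invariant by which infinitely many of these
  axes will be told apart.\<close>

lemma lam_tau_x: "axis (tau x a)" "lam a (tau x a) = (\<beta> + c * \<gamma>) * (\<beta> + c * \<gamma>)"
proof -
  show "axis (tau x a)" by (rule automorphism_axis[OF automorphism_tau_x a])
  have "tau x a = (1/2) *s (e + ((2 * (\<beta> + c * \<gamma>)) *s v - p))"
    using arg_cong[OF a_eq, of "tau x"] by (simp add: linear_map_simps[OF linear_map_tau] tau_x_e tau_x_pq)
  then have "lam a (tau x a) = form ((1/2) *s (e + p)) ((1/2) *s (e + ((2 * (\<beta> + c * \<gamma>)) *s v - p)))"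
    unfolding form_axis_left[OF a, symmetric] using a_eq by simp
  also have "\<dots> = (\<beta> + c * \<gamma>) * (\<beta> + c * \<gamma>)"
    by (simp add: form_simps v_def form_table) (simp add: field_simps)
  finally show "lam a (tau x a) = (\<beta> + c * \<gamma>) * (\<beta> + c * \<gamma>)" .
qed

end

section \<open>Infinitely many axes from the rational points of the conic\<close>

lemma finite_square_vimage:
  fixes H :: "'a::idom set"
  assumes "finite H"
  shows "finite {t. t * t \<in> H}"
proof -
  have "finite {t. t * t = h}" for h :: 'a
  proof (cases "\<exists>t. t * t = h")
    case True
    then obtain t0 where "t0 * t0 = h" by blast
    then have "{t. t * t = h} \<subseteq> {t0, - t0}" by (auto simp: square_eq_iff)
    then show ?thesis by (rule finite_subset) simp
  qed simp
  moreover have "{t. t * t \<in> H} = (\<Union>h\<in>H. {t. t * t = h})" by auto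
  ultimately show ?thesis using assms by simp
qed

context generic_pair
begin

text \<open>The unit vectors are parametrised by the lines through \<open>p\<close> of direction \<open>m p + q\<close>.\<close>

lemma infinite_axes: "infinite axes"
proof
  assume fin: "finite axes"
  define H where "H = (lam a) ` axes"
  define S where "S = {s. s * s \<in> H}"
  \<comment> \<open>With s = \<beta> + c \<gamma>, the slope m of a line satisfies (m + c)^2 = (1 -
    s)(1 - c^2)/(1 + s), so finitely many values of s leave finitely many slopes. The extra element
    c^2 - 1 is (m + c)^2 for an isotropic direction, d = 0.\<close>
  define T where "T = insert (c * c - 1) ((\<lambda>s. (1 - s) * (1 - c * c) / (1 + s)) ` S)"
  have "finite T"
    unfolding T_def S_def H_def using fin by (intro finite.insertI finite_imageI finite_square_vimage)
  then have "finite {t. t * t \<in> T}" by (rule finite_square_vimage)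
  moreover have "of_nat n + c \<in> {t. t * t \<in> T}" for n :: nat
  proof -
    define m :: 'k where "m = of_nat n"
    define d where "d = m * m + 2 * c * m + 1"
    have sq: "(m + c) * (m + c) = d - (1 - c * c)" by (simp add: d_def algebra_simps)
    have "(m + c) * (m + c) \<in> T"
    proof (cases "d = 0")
      case True
      then show ?thesis by (simp add: sq T_def)
    next
      case False
      \<comment> \<open>The second intersection of the conic with the line p + g (m p + q):
        substitution gives 1 + g (2 (m + c) + g d) = 1, with g = 0 being the point \<open>p\<close>
        itself.\<close>
      define g where "g = - 2 * (m + c) / d"
      define f where "f = 1 + m * g"
      have gd: "g * d = - 2 * (m + c)" using False by (simp add: g_def)
      have "f * f + g * g + 2 * c * f * g = 1 + g * (2 * (m + c) + g * d)"
        by (simp add: f_def d_def algebra_simps)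
      then have unit: "f * f + g * g + 2 * c * f * g = 1" by (simp add: gd)
      interpret unit_vector scale mul a b c f g
        by unfold_locales (rule unit)
      define s where "s = f + c * g"
      have "s * s \<in> H" unfolding s_def H_def using lam_tau_x by (metis image_eqI mem_Collect_eq)
      then have "s \<in> S" by (simp add: S_def)
      have "s * d = d + (m + c) * (g * d)" by (simp add: s_def f_def algebra_simps)
      also have "\<dots> = d - 2 * (d - (1 - c * c))" unfolding gd sq[symmetric] by (simp add: algebra_simps)
      finally have sd: "(1 + s) * d = 2 * (1 - c * c)" by (simp add: algebra_simps)
      have "1 - c * c = (1 - c) * (1 + c)" by (simp add: algebra_simps)
      then have "1 - c * c \<noteq> 0" using c_neq by (simp add: eq_neg_iff_add_eq_0 add.commute)
      with sd have s1: "1 + s \<noteq> 0" by auto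
      have "(1 + s) * ((m + c) * (m + c)) = (1 - s) * (1 - c * c)"
        unfolding sq right_diff_distrib sd by (simp add: algebra_simps)
      then have "(m + c) * (m + c) = (1 - s) * (1 - c * c) / (1 + s)"
        using s1 by (simp add: field_simps)
      then show ?thesis using \<open>s \<in> S\<close> by (simp add: T_def)
    qed
    then show ?thesis by (simp add: m_def)
  qed
  ultimately have "finite (range (\<lambda>n::nat. of_nat n + c))"
    by (meson finite_subset image_subsetI)
  moreover have "inj (\<lambda>n::nat. of_nat n + c)" by (auto simp: inj_def)
  ultimately show False by (simp add: finite_image_iff)
qed

end

section \<open>The 3-transposition group\<close>

context group
begin

lemma ord_eq_2:
  assumes "x \<in> carrier G" "x \<noteq> \<one>" "x \<otimes> x = \<one>"
  shows "ord x = 2"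
proof -
  have "x [^] (2::nat) = \<one>" using assms by (simp add: numeral_2_eq_2)
  then have dvd: "ord x dvd 2" using assms by (simp add: pow_eq_id)
  have "ord x \<noteq> 1" using assms ord_eq_1 by metis
  moreover have "ord x \<le> 2" using dvd by (simp add: dvd_imp_le)
  moreover have "ord x \<noteq> 0" using dvd by (metis dvd_0_left_iff zero_neq_numeral)
  ultimately show ?thesis by linarith
qed

lemma ord_eq_3:
  assumes "x \<in> carrier G" "x \<noteq> \<one>" "x \<otimes> x \<otimes> x = \<one>"
  shows "ord x = 3"
proof -
  have "x [^] (3::nat) = \<one>" using assms by (simp add: numeral_3_eq_3)
  then have dvd: "ord x dvd 3" using assms by (simp add: pow_eq_id)
  have "ord x \<noteq> 1" using assms ord_eq_1 by metis
  moreover have "ord x \<le> 3" using dvd by (simp add: dvd_imp_le)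
  moreover have "ord x \<noteq> 0" using dvd by (metis dvd_0_left_iff zero_neq_numeral)
  moreover have "ord x \<noteq> 2" using dvd by auto
  ultimately show ?thesis by linarith
qed

lemma inv_of_involution: "x \<in> carrier G \<Longrightarrow> x \<otimes> x = \<one> \<Longrightarrow> inv x = x"
  by (rule inv_equality)

text \<open>Invariance under conjugation is needed only for the generators, which are their own
  inverses; induction over \<open>generate\<close> extends it to the whole group.\<close>

lemma three_transp_groupI:
  assumes gen: "generate G D = carrier G"
    and D: "D \<subseteq> carrier G" "\<And>d. d \<in> D \<Longrightarrow> d \<noteq> \<one> \<and> d \<otimes> d = \<one>"
    and conj: "\<And>c d. c \<in> D \<Longrightarrow> d \<in> D \<Longrightarrow> d \<otimes> c \<otimes> d \<in> D"
    and order: "\<And>c d. c \<in> D \<Longrightarrow> d \<in> D \<Longrightarrow> c \<noteq> d \<Longrightarrow> ord (c \<otimes> d) \<in> {2, 3}"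
  shows "three_transp_group G D"
proof -
  have "\<forall>d\<in>D. inv g \<otimes> d \<otimes> g \<in> D" if "g \<in> generate G D" for g
    using that
  proof induction
    case one
    then show ?case using D by auto
  next
    case (incl h)
    then show ?case using D conj inv_of_involution[of h] by auto
  next
    case (inv h)
    then show ?case using D conj inv_of_involution[of h] by auto
  next
    case (eng g h)
    then have gh: "g \<in> carrier G" "h \<in> carrier G" by (simp_all add: gen)
    have "inv (g \<otimes> h) \<otimes> d \<otimes> (g \<otimes> h) = inv h \<otimes> (inv g \<otimes> d \<otimes> g) \<otimes> h" if "d \<in> D" for d
      using gh D(1) that by (simp add: inv_mult_group m_assoc subsetD)
    with eng show ?case by metis
  qed
  moreover have "ord (c \<otimes> d) \<in> {1, 2, 3}" if "c \<in> D" "d \<in> D" for c d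
  proof (cases "c = d")
    case True
    then have "c \<otimes> d = \<one>" using D(2) that by simp
    then show ?thesis by simp
  qed (use order that in auto)
  ultimately show ?thesis
    unfolding three_transp_group_def
    using D gen ord_eq_2 by (simp add: group_axioms subset_iff)
qed

end

definition bijections :: "('a \<Rightarrow> 'a) monoid" where
  "bijections = \<lparr>carrier = {f. bij f}, monoid.mult = (\<circ>), one = id\<rparr>"

lemma group_bijections: "group bijections"
proof (rule groupI)
  fix f :: "'a \<Rightarrow> 'a" assume "f \<in> carrier bijections"
  then have f: "bij f" by (simp add: bijections_def)
  then have "bij (the_inv f)" "the_inv f \<circ> f = id"
    by (auto simp: bij_betw_the_inv_into the_inv_f_f bij_is_inj)
  then show "\<exists>g\<in>carrier bijections. g \<otimes>\<^bsub>bijections\<^esub> f = \<one>\<^bsub>bijections\<^esub>"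
    by (auto simp: bijections_def)
qed (auto simp: bijections_def bij_comp)

locale finite_half_algebra = half_algebra scale mul
  for scale :: "'k::field_char_0 \<Rightarrow> 'v::ab_group_add \<Rightarrow> 'v" (infixr "*s" 75)
    and mul :: "'v \<Rightarrow> 'v \<Rightarrow> 'v" (infixl "\<cdot>" 70) +
  assumes finite_axes: "finite axes"
begin

lemma lam_cases:
  assumes x: "axis x" and y: "axis y" and "x \<noteq> y"
  shows "lam x y = 0 \<or> lam x y = 1/4"
proof (rule ccontr)
  assume neg: "\<not> ?thesis"
  \<comment> \<open>The values 1, 0 and 1/4 of \<open>lam x y\<close> correspond to c = 1, -1 and
    -1/2.\<close>
  define c where "c = 2 * lam x y - 1"
  have "lam x y \<noteq> 1" using eq_of_lam_one[OF finite_axes x y] assms(3) by blast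
  with neg have "c \<noteq> 1" "c \<noteq> - 1" "2 * c + 1 \<noteq> 0"
    by (auto simp: c_def algebra_simps eq_neg_iff_add_eq_0)
  then interpret generic_pair scale mul x y c
    by unfold_locales (simp_all add: x y c_def)
  show False using infinite_axes finite_axes by blast
qed

text \<open>For the value 1/4 the formula for \<open>tau x y\<close> becomes x + y - 4 x y, which is
  symmetric; solved for x y it is the Matsuo product.\<close>

lemma commuting_or_noncommuting:
  assumes x: "axis x" and y: "axis y" and "x \<noteq> y"
  obtains (commuting) "x \<cdot> y = 0" "tau x y = y" "tau y x = x"
  | (noncommuting) "tau x y = tau y x" "tau x y \<noteq> x" "tau x y \<noteq> y" "x \<cdot> y = (1/4) *s (x + y - tau y x)"
  using lam_cases[OF assms]
proof (elim disjE)
  assume l: "lam x y = 0"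
  then have "x \<cdot> y = 0" by (rule mul_zero_of_lam_zero[OF finite_axes x y])
  moreover have "lam y x = 0" using l lam_commute[OF x y] by simp
  ultimately show ?thesis
    using l by (intro commuting) (simp_all add: tau_axis x y mul_commute[of y x])
next
  assume l: "lam x y = 1/4"
  then have l': "lam y x = 1/4" using lam_commute[OF x y] by simp
  have eq: "tau x y = tau y x"
    unfolding tau_axis[OF x] tau_axis[OF y] l l' by (simp add: mul_commute)
  have "tau x y \<noteq> x" using eq assms(3) tau_self[OF x] tau_tau[OF x, of y] by metis
  moreover have "tau x y \<noteq> y" using eq assms(3) tau_self[OF y] tau_tau[OF y, of x] by metis
  moreover have "x \<cdot> y = (1/4) *s (x + y - tau y x)"
    unfolding tau_axis[OF y] l' mul_commute[of y x]
    by (rule functional_eqI) (simp add: functional_simps)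
  ultimately show ?thesis using eq by (intro noncommuting)
qed

text \<open>An axis \<open>w\<close> moved by the common involution satisfies tau w x = tau x w =
  tau y w = tau w y, whence x = y. So all axes are fixed, and they span.\<close>

lemma tau_eq_id:
  assumes x: "axis x" and y: "axis y" and "x \<noteq> y" and eq: "tau x = tau y"
  shows "tau x = id"
proof
  fix u
  have "tau x w = w" if w: "axis w" for w
  proof (cases "w = x \<or> w = y")
    case True
    then show ?thesis using tau_self x y eq by metis
  next
    case False
    show ?thesis
    proof (rule commuting_or_noncommuting[OF x w])
      assume "tau x w = tau w x" "tau x w \<noteq> w"
      moreover have "tau y w = tau w y"
        using \<open>tau x w \<noteq> w\<close> False by (cases rule: commuting_or_noncommuting[OF y w]) (auto simp: eq)
      ultimately have "tau w x = tau w y" by (simp add: eq)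
      then show ?thesis using \<open>x \<noteq> y\<close> tau_tau[OF w] by metis
    qed (use False in auto)
  qed
  then show "tau x u = id u"
    by (induction u rule: axes_induct) (simp_all add: linear_map_simps[OF linear_map_tau])
qed

lemma tau_id_commuting:
  assumes x: "axis x" and y: "axis y" and "x \<noteq> y" and "tau x = id"
  shows "x \<cdot> y = 0" "lam x y = 0" "lam y x = 0" "tau y x = x"
proof -
  show "x \<cdot> y = 0" "tau y x = x"
    using assms by (cases rule: commuting_or_noncommuting[OF x y \<open>x \<noteq> y\<close>]; simp)+
  then show "lam x y = 0" "lam y x = 0"
    using lam_orth[OF x] lam_commute[OF x y] by simp_all
qed

text \<open>Distinct axes may have the same Miyamoto involution, but only if that is the identity. Such an
  axis is represented by its reflection instead, which makes \<open>transp\<close> injective on axes.\<close>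

definition transp :: "'v \<Rightarrow> 'v \<Rightarrow> 'v" where
  "transp x = (if tau x = id then (\<lambda>u. u - (2 * lam x u) *s x) else tau x)"

lemma transp_transp:
  assumes x: "axis x"
  shows "transp x (transp x u) = u"
  unfolding transp_def
  by (auto simp: x functional_simps[OF functional_lam[OF x]] lam_self intro!: functional_eqI)

lemma transp_comp: "axis x \<Longrightarrow> transp x \<circ> transp x = id"
  by (auto simp: transp_transp)

lemma bij_transp: "axis x \<Longrightarrow> bij (transp x)"
  by (rule o_bij[of "transp x"]) (auto simp: transp_transp)

lemma axis_neq_minus: "axis x \<Longrightarrow> - x \<noteq> x"
proof
  assume "axis x" "- x = x"
  then have "2 *s x = 0" by (metis add.right_inverse scale_left_distrib one_add_one scale_one)
  with axis_nonzero[OF \<open>axis x\<close>] show False by simp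
qed

lemma transp_self:
  assumes x: "axis x" and "tau x = id"
  shows "transp x x = - x"
  by (rule functional_eqI) (simp add: transp_def assms lam_self functional_simps)

lemma transp_not_id:
  assumes x: "axis x"
  shows "transp x \<noteq> id"
proof (cases "tau x = id")
  case True
  then show ?thesis using transp_self[OF x] axis_neq_minus[OF x] by (metis id_apply)
qed (simp add: transp_def)

lemma transp_other:
  assumes x: "axis x" and y: "axis y" and "x \<noteq> y"
  shows "transp y x = tau y x"
  using tau_id_commuting[OF y x] assms by (auto simp: transp_def)

text \<open>A reflection negates its own axis, but the transposition of any other axis fixes that
  axis. Two nontrivial Miyamoto involutions are separated by \<open>tau_eq_id\<close>.\<close>

lemma inj_on_transp: "inj_on transp axes"
proof (rule inj_onI, rule ccontr)
  fix x y assume "x \<in> axes" "y \<in> axes" and eq: "transp x = transp y" and ne: "x \<noteq> y"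
  then have x: "axis x" and y: "axis y" by auto
  have not_id: "tau u \<noteq> id" if "axis u" "axis w" "transp u = transp w" "u \<noteq> w" for u w
  proof
    assume id: "tau u = id"
    have "- u = transp w u" using transp_self[OF that(1) id] that(3) by simp
    also have "\<dots> = u" using transp_other[OF that(1,2,4)] tau_id_commuting(4)[OF that(1,2,4) id] by simp
    finally show False using axis_neq_minus[OF that(1)] by blast
  qed
  have "tau x \<noteq> id" "tau y \<noteq> id" using not_id[OF x y eq ne] not_id[OF y x] eq ne by auto
  then have "tau x = tau y" using eq by (simp add: transp_def)
  with tau_eq_id[OF x y ne] \<open>tau x \<noteq> id\<close> show False by blast
qed

lemma transp_automorphism:
  assumes g: "automorphism g" and x: "axis x"
  shows "transp (g x) (g u) = g (transp x u)"
proof -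
  have lin: "linear_map g" and bij: "bij g" using g by (auto simp: automorphism_def)
  have "tau (g x) = id \<longleftrightarrow> tau x = id"
  proof
    assume "tau (g x) = id"
    then have "g (tau x w) = g w" for w using tau_automorphism[OF g, of x w] by simp
    then show "tau x = id" using bij by (auto simp: bij_is_inj inj_eq)
  next
    assume id: "tau x = id"
    show "tau (g x) = id"
    proof
      fix w
      obtain u where "w = g u" using bij by (metis bij_pointE)
      then show "tau (g x) w = id w" using tau_automorphism[OF g, of x u] id by simp
    qed
  qed
  then show ?thesis
    by (simp add: transp_def tau_automorphism[OF g] lam_automorphism[OF g x] linear_map_simps[OF lin])
qed

text \<open>If \<open>tau y\<close> is nontrivial it is an automorphism, and transport of structure
  applies. Otherwise \<open>transp y\<close> is only a reflection, but then every other axis is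
  orthogonal to \<open>y\<close> and the two transpositions commute.\<close>

lemma transp_conj:
  assumes x: "axis x" and y: "axis y"
  shows "transp y \<circ> transp x \<circ> transp y = transp (tau y x)"
proof
  fix u
  show "(transp y \<circ> transp x \<circ> transp y) u = transp (tau y x) u"
  proof (cases "tau y = id")
    case False
    then show ?thesis
      using transp_automorphism[OF automorphism_tau[OF y] x, of "tau y u"] y by (simp add: transp_def[of y])
  next
    case id: True
    show ?thesis
    proof (cases "x = y")
      case True
      then show ?thesis by (simp add: transp_transp y tau_self)
    next
      case False
      have "transp x (transp y u) = transp y (transp x u)"
      proof (cases "tau x = id")
        case True
        then show ?thesis
          using tau_id_commuting(2,3)[OF x y False]
          by (auto intro!: functional_eqI simp: transp_def id functional_simps[OF functional_lam[OF x]]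
               functional_simps[OF functional_lam[OF y]] functional_simps)
      next
        case False
        have "tau x y = y" using tau_id_commuting(4)[OF y x] \<open>x \<noteq> y\<close> id by simp
        with False show ?thesis
          using transp_automorphism[OF automorphism_tau[OF x] y, of u] by (simp add: transp_def[of x])
      qed
      then show ?thesis by (simp add: id transp_transp y)
    qed
  qed
qed

section \<open>The group generated by the transpositions\<close>

definition miyamoto_group :: "('v \<Rightarrow> 'v) monoid" where
  "miyamoto_group = bijections\<lparr>carrier := generate bijections (transp ` axes)\<rparr>"

lemma miyamoto_group_simps:
  "f \<otimes>\<^bsub>miyamoto_group\<^esub> g = f \<circ> g" "\<one>\<^bsub>miyamoto_group\<^esub> = id"
  by (simp_all add: miyamoto_group_def bijections_def)

lemma transps_subset: "transp ` axes \<subseteq> carrier bijections"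
  by (auto simp: bijections_def bij_transp)

lemma group_miyamoto: "group miyamoto_group"
  unfolding miyamoto_group_def
  by (rule subgroup.subgroup_is_group[OF group.generate_is_subgroup group_bijections])
     (rule group_bijections, rule transps_subset)

lemma generate_miyamoto: "generate miyamoto_group (transp ` axes) = carrier miyamoto_group"
  unfolding miyamoto_group_def
  by (subst group.generate_consistent[OF group_bijections])
     (auto intro: generate.incl group.generate_is_subgroup[OF group_bijections transps_subset])

lemma transp_carrier: "axis x \<Longrightarrow> transp x \<in> carrier miyamoto_group"
  unfolding generate_miyamoto[symmetric] by (rule generate.incl) simp

lemma inv_transp: "axis x \<Longrightarrow> inv\<^bsub>miyamoto_group\<^esub> (transp x) = transp x"
  by (rule group.inv_of_involution[OF group_miyamoto transp_carrier])
     (simp_all add: miyamoto_group_simps transp_comp)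

lemma ord_transp:
  assumes x: "axis x" and y: "axis y" and ne: "x \<noteq> y"
  shows "tau y x = x \<Longrightarrow> group.ord miyamoto_group (transp x \<otimes>\<^bsub>miyamoto_group\<^esub> transp y) = 2"
    and "tau y x = tau x y \<Longrightarrow> group.ord miyamoto_group (transp x \<otimes>\<^bsub>miyamoto_group\<^esub> transp y) = 3"
proof -
  let ?d = "transp x \<otimes>\<^bsub>miyamoto_group\<^esub> transp y"
  interpret G: group miyamoto_group by (rule group_miyamoto)
  have d: "?d \<in> carrier miyamoto_group" by (simp add: transp_carrier x y)
  have "?d \<noteq> \<one>\<^bsub>miyamoto_group\<^esub>"
  proof
    assume "?d = \<one>\<^bsub>miyamoto_group\<^esub>"
    then have "inv\<^bsub>miyamoto_group\<^esub> (transp y) = transp x"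
      by (rule G.inv_equality) (simp_all add: transp_carrier x y)
    then have "transp y = transp x" by (simp add: inv_transp y)
    then show False using inj_on_transp ne x y by (auto dest: inj_onD)
  qed
  note d = d this
  have xy: "transp y \<circ> transp x \<circ> transp y = transp (tau y x)" "transp x \<circ> transp y \<circ> transp x = transp (tau x y)"
    by (simp_all add: transp_conj x y)
  have xx: "transp x \<circ> transp x = id" "transp y \<circ> transp y = id" by (simp_all add: transp_comp x y)
  show "G.ord ?d = 2" if "tau y x = x"
  proof (rule G.ord_eq_2[OF d])
    have "transp x \<circ> (transp y \<circ> transp x \<circ> transp y) = id" by (simp add: xy(1) that xx)
    then show "?d \<otimes>\<^bsub>miyamoto_group\<^esub> ?d = \<one>\<^bsub>miyamoto_group\<^esub>"
      by (simp add: miyamoto_group_simps o_assoc)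
  qed
  show "G.ord ?d = 3" if "tau y x = tau x y"
  proof (rule G.ord_eq_3[OF d])
    \<comment> \<open>The cube of the product, regrouped as (xyx)(yxy): both factors are the
      involution of the common third axis.\<close>
    have "(transp x \<circ> transp y \<circ> transp x) \<circ> (transp y \<circ> transp x \<circ> transp y) = id"
      using transp_comp[OF axis_tau[OF x y]] by (simp only: xy that)
    then show "?d \<otimes>\<^bsub>miyamoto_group\<^esub> ?d \<otimes>\<^bsub>miyamoto_group\<^esub> ?d = \<one>\<^bsub>miyamoto_group\<^esub>"
      by (simp add: miyamoto_group_simps o_assoc)
  qed
qed

lemma three_transp_miyamoto: "three_transp_group miyamoto_group (transp ` axes)"
proof (rule group.three_transp_groupI[OF group_miyamoto generate_miyamoto])
  show "transp ` axes \<subseteq> carrier miyamoto_group" by (auto simp: transp_carrier)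
next
  fix d assume "d \<in> transp ` axes"
  then show "d \<noteq> \<one>\<^bsub>miyamoto_group\<^esub> \<and> d \<otimes>\<^bsub>miyamoto_group\<^esub> d = \<one>\<^bsub>miyamoto_group\<^esub>"
    by (auto simp: miyamoto_group_simps transp_comp transp_not_id)
next
  fix c d assume "c \<in> transp ` axes" "d \<in> transp ` axes"
  then obtain x y where xy: "axis x" "axis y" "c = transp x" "d = transp y" by auto
  show "d \<otimes>\<^bsub>miyamoto_group\<^esub> c \<otimes>\<^bsub>miyamoto_group\<^esub> d \<in> transp ` axes"
    using transp_conj[OF xy(1,2)] axis_tau[OF xy(2,1)] by (simp add: miyamoto_group_simps xy)
  assume "c \<noteq> d"
  then have "x \<noteq> y" using xy by auto
  then show "group.ord miyamoto_group (c \<otimes>\<^bsub>miyamoto_group\<^esub> d) \<in> {2, 3}"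
    using ord_transp[OF xy(1,2)] unfolding xy(3,4)
    by (cases rule: commuting_or_noncommuting[OF xy(1,2)]) auto
qed

section \<open>Evaluation of the Matsuo algebra at the axes\<close>

definition eval_transp :: "(('v \<Rightarrow> 'v) \<Rightarrow> 'k) \<Rightarrow> 'v" where
  "eval_transp m = (\<Sum>x\<in>axes. m (transp x) *s x)"

lemma transp_eq_iff: "axis x \<Longrightarrow> axis y \<Longrightarrow> transp x = transp y \<longleftrightarrow> x = y"
  using inj_on_transp by (auto dest: inj_onD)

lemma eval_delta: "axis x \<Longrightarrow> eval_transp (delta (transp x)) = x"
proof -
  assume x: "axis x"
  have "eval_transp (delta (transp x)) = (\<Sum>y\<in>axes. if y = x then x else 0)"
    unfolding eval_transp_def delta_def by (rule sum.cong) (auto simp: transp_eq_iff x)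
  then show ?thesis using finite_axes x by simp
qed

lemma
  shows eval_add: "eval_transp (\<lambda>e. m e + n e) = eval_transp m + eval_transp n"
    and eval_diff: "eval_transp (\<lambda>e. m e - n e) = eval_transp m - eval_transp n"
    and eval_scale: "eval_transp (\<lambda>e. r * m e) = r *s eval_transp m"
    and eval_sum: "eval_transp (\<lambda>e. \<Sum>i\<in>I. h i e) = (\<Sum>i\<in>I. eval_transp (h i))"
  unfolding eval_transp_def
  by (simp_all add: scale_left_distrib scale_left_diff_distrib sum.distrib sum_subtractf scale_sum_right scale_sum_left)
     (rule sum.swap)

lemma eval_bprod:
  assumes x: "axis x" and y: "axis y"
  shows "eval_transp (matsuo_bprod miyamoto_group (transp x) (transp y)) = x \<cdot> y"
proof (cases "x = y")
  case True
  then show ?thesis by (simp add: matsuo_bprod_def eval_delta x axis_idem y)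
next
  case False
  then have ne: "transp x \<noteq> transp y" by (simp add: transp_eq_iff x y)
  from x y False show ?thesis
  proof (cases rule: commuting_or_noncommuting)
    case commuting
    then show ?thesis using ne ord_transp(1)[OF x y False] by (simp add: matsuo_bprod_def eval_transp_def)
  next
    case noncommuting
    have "inv\<^bsub>miyamoto_group\<^esub> (transp y) \<otimes>\<^bsub>miyamoto_group\<^esub> transp x \<otimes>\<^bsub>miyamoto_group\<^esub> transp y = transp (tau y x)"
      by (simp only: inv_transp y miyamoto_group_simps transp_conj x)
    then have "eval_transp (matsuo_bprod miyamoto_group (transp x) (transp y))
      = eval_transp (\<lambda>e. (1/4) * (delta (transp x) e + delta (transp y) e - delta (transp (tau y x)) e))"
      using ne ord_transp(2)[OF x y False] noncommuting by (simp add: matsuo_bprod_def)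
    also have "\<dots> = x \<cdot> y"
      unfolding eval_scale eval_diff eval_add eval_delta[OF x] eval_delta[OF y] eval_delta[OF axis_tau[OF y x]]
      by (simp add: noncommuting)
    finally show ?thesis .
  qed
qed

text \<open>Sums over supports depend on the arguments; sums over the finite set of all axes do not,
  and bilinearity becomes visible.\<close>

lemma matsuo_mul_eq:
  fixes m n :: "('v \<Rightarrow> 'v) \<Rightarrow> 'k"
  assumes "m \<in> matsuo_carrier (transp ` axes)" "n \<in> matsuo_carrier (transp ` axes)"
  shows "matsuo_mul miyamoto_group m n = (\<lambda>e. \<Sum>x\<in>axes. \<Sum>y\<in>axes.
    (m (transp x) * n (transp y)) * matsuo_bprod miyamoto_group (transp x) (transp y) e)"
proof
  fix e
  have reindex: "(\<Sum>d\<in>{d. k d \<noteq> 0}. k d * g d) = (\<Sum>x\<in>axes. k (transp x) * g (transp x))"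
    if "k \<in> matsuo_carrier (transp ` axes)" for k g :: "('v \<Rightarrow> 'v) \<Rightarrow> 'k"
  proof -
    have "(\<Sum>d\<in>{d. k d \<noteq> 0}. k d * g d) = (\<Sum>d\<in>transp ` axes. k d * g d)"
      using that finite_axes by (intro sum.mono_neutral_left) (auto simp: matsuo_carrier_def)
    also have "\<dots> = (\<Sum>x\<in>axes. k (transp x) * g (transp x))"
      using inj_on_transp by (simp add: sum.reindex)
    finally show ?thesis .
  qed
  show "matsuo_mul miyamoto_group m n e = (\<Sum>x\<in>axes. \<Sum>y\<in>axes.
    (m (transp x) * n (transp y)) * matsuo_bprod miyamoto_group (transp x) (transp y) e)"
    unfolding matsuo_mul_def mult.assoc sum_distrib_left[symmetric] reindex[OF assms(1)] reindex[OF assms(2)] ..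
qed

lemma eval_mul:
  fixes m n :: "('v \<Rightarrow> 'v) \<Rightarrow> 'k"
  assumes "m \<in> matsuo_carrier (transp ` axes)" "n \<in> matsuo_carrier (transp ` axes)"
  shows "eval_transp (matsuo_mul miyamoto_group m n) = eval_transp m \<cdot> eval_transp n"
proof -
  have sum_left: "(\<Sum>i\<in>I. h i) \<cdot> w = (\<Sum>i\<in>I. h i \<cdot> w)" for h w and I :: "'v set"
    by (induction I rule: infinite_finite_induct) (simp_all add: mul_simps)
  have sum_right: "w \<cdot> (\<Sum>i\<in>I. h i) = (\<Sum>i\<in>I. w \<cdot> h i)" for h w and I :: "'v set"
    by (induction I rule: infinite_finite_induct) (simp_all add: mul_simps)
  have "eval_transp (matsuo_mul miyamoto_group m n)
    = (\<Sum>x\<in>axes. \<Sum>y\<in>axes. (m (transp x) * n (transp y)) *s (x \<cdot> y))"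
    unfolding matsuo_mul_eq[OF assms] eval_sum eval_scale
    by (intro sum.cong refl) (simp add: eval_bprod)
  also have "\<dots> = eval_transp m \<cdot> eval_transp n"
    unfolding eval_transp_def sum_left unfolding sum_right by (simp add: mul_simps mult.commute)
  finally show ?thesis .
qed

lemma matsuo_mul_carrier:
  fixes m n :: "('v \<Rightarrow> 'v) \<Rightarrow> 'k"
  assumes "m \<in> matsuo_carrier (transp ` axes)" "n \<in> matsuo_carrier (transp ` axes)"
  shows "matsuo_mul miyamoto_group m n \<in> matsuo_carrier (transp ` axes)"
proof -
  have "matsuo_bprod miyamoto_group (transp x) (transp y) e = (0::'k)"
    if "axis x" "axis y" "e \<notin> transp ` axes" for x y e
  proof -
    have "inv\<^bsub>miyamoto_group\<^esub> (transp y) \<otimes>\<^bsub>miyamoto_group\<^esub> transp x \<otimes>\<^bsub>miyamoto_group\<^esub> transp y = transp (tau y x)"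
      by (simp only: inv_transp that miyamoto_group_simps transp_conj)
    with that axis_tau[OF that(2,1)] show ?thesis
      by (auto simp: matsuo_bprod_def delta_def)
  qed
  then have zero: "matsuo_mul miyamoto_group m n e = 0" if "e \<notin> transp ` axes" for e
    unfolding matsuo_mul_eq[OF assms] using that by (intro sum.neutral ballI) simp
  then have "{e. matsuo_mul miyamoto_group m n e \<noteq> 0} \<subseteq> transp ` axes" by auto
  then show ?thesis
    using zero finite_axes by (auto simp: matsuo_carrier_def intro: finite_subset)
qed

text \<open>The ideal consists of the linear relations among the axes. It is zero exactly when the
  axes are independent, and the factor algebra is then the Matsuo algebra itself.\<close>

lemma iso_matsuo_quot_miyamoto: "iso_matsuo_quot miyamoto_group (transp ` axes) scale mul"
proof -
  let ?M = "matsuo_carrier (transp ` axes) :: (('v \<Rightarrow> 'v) \<Rightarrow> 'k) set"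
  define I where "I = {m \<in> ?M. eval_transp m = 0}"
  have fin: "finite {d. m d \<noteq> (0::'k)}" if "\<forall>d. m d \<noteq> 0 \<longrightarrow> d \<in> transp ` axes" for m
    by (rule finite_subset[of _ "transp ` axes"]) (use that finite_axes in auto)
  have M: "m \<in> ?M \<longleftrightarrow> (\<forall>d. m d \<noteq> 0 \<longrightarrow> d \<in> transp ` axes)" for m
    using fin by (auto simp: matsuo_carrier_def)
  have "eval_transp ` ?M = UNIV"
  proof (intro equalityI subsetI UNIV_I)
    fix u
    have "u \<in> span axes" by (simp add: span_axes)
    then obtain r where r: "u = (\<Sum>x\<in>axes. r x *s x)"
      unfolding span_finite[OF finite_axes] by blast
    define m where "m = (\<lambda>d. if d \<in> transp ` axes then r (inv_into axes transp d) else 0)"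
    have "m \<in> ?M" by (auto simp: M m_def)
    moreover have "eval_transp m = u"
      unfolding eval_transp_def r by (rule sum.cong) (auto simp: m_def inv_into_f_f[OF inj_on_transp])
    ultimately show "u \<in> eval_transp ` ?M" by blast
  qed
  moreover have "matsuo_ideal miyamoto_group (transp ` axes) I"
    unfolding matsuo_ideal_def
  proof (intro conjI ballI allI)
    show "I \<subseteq> ?M" by (auto simp: I_def)
    show "(\<lambda>e. 0) \<in> I" by (simp add: I_def M eval_transp_def)
    show "(\<lambda>e. m e + n e) \<in> I" if "m \<in> I" "n \<in> I" for m n
      using that by (auto simp: I_def M eval_add) (metis add.right_neutral)
    show "(\<lambda>e. t * m e) \<in> I" if "m \<in> I" for t m
      using that by (auto simp: I_def M eval_scale)
    show "matsuo_mul miyamoto_group m n \<in> I" if "m \<in> I" "n \<in> ?M" for m n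
      using that by (auto simp: I_def eval_mul matsuo_mul_carrier)
  qed
  moreover have "matsuo_hom miyamoto_group (transp ` axes) scale mul eval_transp"
    unfolding matsuo_hom_def by (auto simp: eval_add eval_mul eval_scale)
  ultimately show ?thesis
    unfolding iso_matsuo_quot_def using I_def by blast
qed

end

theorem theorem3:
  fixes sc :: "'k::field_char_0 \<Rightarrow> 'v::ab_group_add \<Rightarrow> 'v"
    and mul :: "'v \<Rightarrow> 'v \<Rightarrow> 'v"
  assumes "jordan_type_half_algebra sc mul"
  shows "infinite {x. prim_axis_half sc mul x}
    \<or> (\<exists>(G :: ('v \<Rightarrow> 'v) monoid) D. three_transp_group G D
         \<and> (iso_matsuo G D sc mul \<or> iso_matsuo_quot G D sc mul))"
proof (cases "finite {x. prim_axis_half sc mul x}")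
  case True
  have "comm_algebra sc mul" and gen: "gen_subalg sc mul {x. prim_axis_half sc mul x} = UNIV"
    using assms by (auto simp: jordan_type_half_algebra_def)
  then have *: "vector_space sc" "\<And>u v. mul u v = mul v u"
    "\<And>u v w. mul (u + v) w = mul u w + mul v w" "\<And>r u w. mul (sc r u) w = sc r (mul u w)"
    unfolding comm_algebra_def by blast+
  interpret vector_space sc by (rule *)
  interpret finite_half_algebra sc mul
    by unfold_locales (use * gen True in blast)+
  show ?thesis
    using three_transp_miyamoto iso_matsuo_quot_miyamoto by blast
qed simp

end
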